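(* Let $X$ be a curve of genus $g$ over a finite field, $P$ a rational point and $B,C$ divisors. Then $\#\Delta_P(B,C)-\#\Delta_P(B-C,-C)=\deg C$. Furthermore $\#\Delta_P(B,C)=\deg C$ if $C\in\Gamma_P$, and $\#\Delta_P(B,C)=0$ if $-C\in\Gamma_P$. In particular $\#\Delta_P(B,C)=\deg C$ if $\deg C\geq 2g$, and $\#\Delta_P(B,C)=0$ if $\deg C\leq -2g$.
   Context: $L(E)=\{f:(f)+E\ge0\}\cup\{0\}$; $\Gamma_P$ is the set of divisor classes $A$ with $L(A)\neq L(A-P)$. For divisors $B,C$: $\Delta_P(B,C)=\{B+iP : i\in\mathbb{Z},\ B+iP\in\Gamma_P,\ B-C+iP\notin\Gamma_P\}$ (so $\Delta_P(B-C,-C)=\{B-C+iP: B-C+iP\in\Gamma_P,\ B+iP\notin\Gamma_P\}$). *)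

theory Defs
  imports "HOL-Library.Poly_Mapping" "HOL-Computational_Algebra.Polynomial"
begin

text \<open>
  A curve (smooth, projective, absolutely irreducible) over a finite field is represented by its
  function field: an extension \<open>\<iota> :: 'k \<Rightarrow> 'f\<close> of the finite field \<open>'k\<close> that is finite over a rational
  function field \<open>'k(x)\<close> and in which \<open>'k\<close> is algebraically closed. The closed points of the
  curve are the normalised discrete valuations of the extension.
\<close>

definition eval_in :: "('k::field \<Rightarrow> 'f::field) \<Rightarrow> 'k poly \<Rightarrow> 'f \<Rightarrow> 'f" where
  "eval_in \<iota> p x = poly (map_poly \<iota> p) x"

definition algebraic_over :: "('k::field \<Rightarrow> 'f::field) \<Rightarrow> 'f \<Rightarrow> bool" where
  "algebraic_over \<iota> x \<longleftrightarrow> (\<exists>p. p \<noteq> 0 \<and> eval_in \<iota> p x = 0)"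

definition simple_extension :: "('k::field \<Rightarrow> 'f::field) \<Rightarrow> 'f \<Rightarrow> 'f set" where
  "simple_extension \<iota> x = {eval_in \<iota> p x / eval_in \<iota> q x | p q. eval_in \<iota> q x \<noteq> 0}"

locale function_field =
  fixes \<iota> :: "'k::{field,finite} \<Rightarrow> 'f::field"
  assumes hom_one: "\<iota> 1 = 1"
    and hom_add: "\<iota> (a + b) = \<iota> a + \<iota> b"
    and hom_mult: "\<iota> (a * b) = \<iota> a * \<iota> b"
    and finite_over_rational:
      "\<exists>x. \<not> algebraic_over \<iota> x \<and>
         (\<exists>S. finite S \<and>
            (\<forall>f. \<exists>c. (\<forall>s\<in>S. c s \<in> simple_extension \<iota> x) \<and> f = (\<Sum>s\<in>S. c s * s)))"
    and constants_closed: "algebraic_over \<iota> y \<Longrightarrow> y \<in> range \<iota>"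

abbreviation scale_by :: "('k::field \<Rightarrow> 'f::field) \<Rightarrow> 'k \<Rightarrow> 'f \<Rightarrow> 'f" where
  "scale_by \<iota> \<equiv> (\<lambda>a x. \<iota> a * x)"

lemma (in function_field) vector_space_scale_by: "vector_space (scale_by \<iota>)"
  by unfold_locales (simp_all add: hom_one hom_add hom_mult algebra_simps)

type_synonym 'f point = "'f \<Rightarrow> int"

text \<open>
  The value \<open>\<infinity>\<close> at \<open>0\<close> is replaced by the dummy value \<open>0\<close>, so that distinct functions are
  distinct points; every use below treats the argument \<open>0\<close> separately.
\<close>

definition points :: "('k::field \<Rightarrow> 'f::field) \<Rightarrow> 'f point set" where
  "points \<iota> = {v. v 0 = 0 \<and> surj v \<and>
     (\<forall>a. a \<noteq> 0 \<longrightarrow> v (\<iota> a) = 0) \<and>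
     (\<forall>x y. x \<noteq> 0 \<longrightarrow> y \<noteq> 0 \<longrightarrow> v (x * y) = v x + v y) \<and>
     (\<forall>x y. x \<noteq> 0 \<longrightarrow> y \<noteq> 0 \<longrightarrow> x + y \<noteq> 0 \<longrightarrow> min (v x) (v y) \<le> v (x + y))}"

definition local_ring :: "'f::field point \<Rightarrow> 'f set" where
  "local_ring v = {x. x = 0 \<or> 0 \<le> v x}"

definition max_ideal :: "'f::field point \<Rightarrow> 'f set" where
  "max_ideal v = {x. x = 0 \<or> 0 < v x}"

text \<open>The cosets of the elements of \<open>S\<close> form a basis of the residue field of \<open>v\<close>.\<close>

definition residue_basis :: "('k::field \<Rightarrow> 'f::field) \<Rightarrow> 'f point \<Rightarrow> 'f set \<Rightarrow> bool" where
  "residue_basis \<iota> v S \<longleftrightarrow>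
     S \<subseteq> local_ring v \<and>
     \<not> module.dependent (scale_by \<iota>) S \<and>
     module.span (scale_by \<iota>) S \<inter> max_ideal v = {0} \<and>
     local_ring v = {x + m | x m. x \<in> module.span (scale_by \<iota>) S \<and> m \<in> max_ideal v}"

definition point_degree :: "('k::field \<Rightarrow> 'f::field) \<Rightarrow> 'f point \<Rightarrow> nat" where
  "point_degree \<iota> v = card (SOME S. residue_basis \<iota> v S)"

definition rational_point :: "('k::field \<Rightarrow> 'f::field) \<Rightarrow> 'f point \<Rightarrow> bool" where
  "rational_point \<iota> v \<longleftrightarrow> v \<in> points \<iota> \<and> point_degree \<iota> v = 1"

type_synonym 'f divisor = "'f point \<Rightarrow>\<^sub>0 int"

definition divisors :: "('k::field \<Rightarrow> 'f::field) \<Rightarrow> 'f divisor set" where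
  "divisors \<iota> = {D. Poly_Mapping.keys D \<subseteq> points \<iota>}"

definition divisor_degree :: "('k::field \<Rightarrow> 'f::field) \<Rightarrow> 'f divisor \<Rightarrow> int" where
  "divisor_degree \<iota> D =
     (\<Sum>v\<in>Poly_Mapping.keys D. Poly_Mapping.lookup D v * int (point_degree \<iota> v))"

definition principal_divisors :: "('k::field \<Rightarrow> 'f::field) \<Rightarrow> 'f divisor set" where
  "principal_divisors \<iota> =
     {D \<in> divisors \<iota>. \<exists>f. f \<noteq> 0 \<and> (\<forall>v\<in>points \<iota>. Poly_Mapping.lookup D v = v f)}"

definition divisor_class :: "('k::field \<Rightarrow> 'f::field) \<Rightarrow> 'f divisor \<Rightarrow> 'f divisor set" where
  "divisor_class \<iota> D = {D' \<in> divisors \<iota>. D' - D \<in> principal_divisors \<iota>}"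

definition RR_space :: "('k::field \<Rightarrow> 'f::field) \<Rightarrow> 'f divisor \<Rightarrow> 'f set" where
  "RR_space \<iota> E =
     {f. f \<noteq> 0 \<and> (\<forall>v\<in>points \<iota>. 0 \<le> v f + Poly_Mapping.lookup E v)} \<union> {0}"

definition RR_dim :: "('k::field \<Rightarrow> 'f::field) \<Rightarrow> 'f divisor \<Rightarrow> nat" where
  "RR_dim \<iota> E = vector_space.dim (scale_by \<iota>) (RR_space \<iota> E)"

text \<open>The supremum is a maximum by Riemann's theorem.\<close>

definition genus :: "('k::field \<Rightarrow> 'f::field) \<Rightarrow> int" where
  "genus \<iota> = (SUP A\<in>divisors \<iota>. divisor_degree \<iota> A - int (RR_dim \<iota> A) + 1)"

definition multiple :: "int \<Rightarrow> 'f point \<Rightarrow> 'f divisor" where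
  "multiple i P = Poly_Mapping.single P i"

definition Gamma :: "('k::field \<Rightarrow> 'f::field) \<Rightarrow> 'f point \<Rightarrow> 'f divisor set set" where
  "Gamma \<iota> P =
     {divisor_class \<iota> A | A. A \<in> divisors \<iota> \<and> RR_space \<iota> A \<noteq> RR_space \<iota> (A - multiple 1 P)}"

definition Delta ::
    "('k::field \<Rightarrow> 'f::field) \<Rightarrow> 'f point \<Rightarrow> 'f divisor \<Rightarrow> 'f divisor \<Rightarrow> 'f divisor set" where
  "Delta \<iota> P B C =
     {B + multiple i P | i. divisor_class \<iota> (B + multiple i P) \<in> Gamma \<iota> P \<and>
        divisor_class \<iota> (B - C + multiple i P) \<notin> Gamma \<iota> P}"

end

theory Submission
  imports Defs "HOL-Library.FuncSet" "HOL-Library.Cardinality"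
begin

text \<open>
  For a divisor \<open>D\<close> the numbers \<open>i\<close> with \<open>D + iP \<in> \<Gamma>\<^sub>P\<close> are those where the dimension of
  \<open>L(D + iP)\<close> jumps, and it jumps by one because \<open>P\<close> is rational. Hence the difference of the
  two cardinalities is the difference of the dimensions of \<open>L(B + iP)\<close> and \<open>L(B - C + iP)\<close> for large
  \<open>i\<close>, which is the degree of \<open>C\<close> by Riemann's theorem. Since \<open>\<Gamma>\<^sub>P\<close> is closed under addition, one of the
  two sets is empty as soon as \<open>C\<close> or \<open>-C\<close> lies in \<open>\<Gamma>\<^sub>P\<close>.

  Membership \<open>C \<in> \<Gamma>\<^sub>P\<close> for \<open>deg C \<ge> 2g\<close> needs no duality: otherwise, for each of the \<open>deg C + 1\<close>
  numbers \<open>0 \<le> i \<le> deg C\<close>, one of \<open>iP\<close> and \<open>C - iP\<close> would not lie in \<open>\<Gamma>\<^sub>P\<close>, but by Riemann's theorem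
  each of these two families misses \<open>\<Gamma>\<^sub>P\<close> exactly \<open>g\<close> times in nonnegative degree.

  Riemann's theorem and the vanishing of the degree of a principal divisor follow from comparing
  \<open>[F : k(x)]\<close> with the degree of the pole divisor of \<open>x\<close>: weak approximation gives one inequality, the
  growth of \<open>L(lX)\<close> for the pole divisor \<open>X\<close> the other. As \<open>k\<close> is finite, dimensions over \<open>k\<close> can be
  counted by cardinalities.
\<close>

section \<open>Polynomial relations in the function field\<close>

context function_field
begin

text \<open>A curve comes with one unspecified \<open>x\<close> such that \<open>F\<close> is finite
  over \<open>k(x)\<close>, but the degree formula is wanted for every nonconstant \<open>y\<close>.
  Linear dependence over the polynomials in \<open>y\<close>, \<open>poly_dependent\<close>, bridges
  this: \<open>ex_rank_bound\<close> gives for each \<open>y\<close> one bound valid for all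
  families. The least such bound plays the role of \<open>[F : k(y)]\<close>, and its symmetry
  between \<open>y\<close> and \<open>1/y\<close> balances zeros against poles. The same bound
  forces valuation rings to be discrete, residue fields to be finite and zeros to be finite in
  number.

  Points are valuations, and nothing in their definition says that there are enough of them; without
  a pole for every nonconstant function even \<open>L(0) = k\<close> would be open. This is why a
  valuation ring is constructed by Zorn's lemma and then shown to be discrete.

  The genus is a supremum of integers and becomes usable once it is known to be bounded. A divisor
  where it is attained, compared with \<open>D + nP\<close> up to principal divisors, yields the
  exact dimension of \<open>L(D + nP)\<close> for large \<open>n\<close>.\<close>

lemma hom_zero [simp]: "\<iota> 0 = 0"
  using hom_add[of 0 0] by (metis add.right_neutral add_left_cancel)

lemma hom_minus: "\<iota> (- a) = - \<iota> a"
proof -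
  have "\<iota> (- a) + \<iota> a = 0" using hom_add[of "- a" a] by simp
  thus ?thesis by (simp add: eq_neg_iff_add_eq_0)
qed

lemma hom_diff: "\<iota> (a - b) = \<iota> a - \<iota> b"
  using hom_add[of a "- b"] by (simp add: hom_minus)

lemma hom_eq_zero_iff [simp]: "\<iota> a = 0 \<longleftrightarrow> a = 0"
proof
  assume "\<iota> a = 0"
  show "a = 0"
  proof (rule ccontr)
    assume "a \<noteq> 0"
    hence "\<iota> a * \<iota> (inverse a) = 1" by (simp flip: hom_mult add: hom_one)
    thus False using \<open>\<iota> a = 0\<close> by simp
  qed
qed simp

lemma hom_inj: "inj \<iota>"
  by (rule injI) (metis hom_diff hom_eq_zero_iff right_minus_eq)

lemma hom_inverse: "\<iota> (inverse a) = inverse (\<iota> a)"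
proof (cases "a = 0")
  case False
  hence "\<iota> a * \<iota> (inverse a) = 1" by (simp flip: hom_mult add: hom_one)
  thus ?thesis by (metis inverse_unique)
qed simp

section \<open>Subalgebras and polynomials with coefficients in them\<close>

definition subalg :: "'f set \<Rightarrow> bool" where
  "subalg A \<longleftrightarrow> range \<iota> \<subseteq> A \<and> (\<forall>a\<in>A. \<forall>b\<in>A. a + b \<in> A \<and> a * b \<in> A)"

lemma subalg_const: "subalg A \<Longrightarrow> \<iota> c \<in> A"
  and subalg_add: "subalg A \<Longrightarrow> a \<in> A \<Longrightarrow> b \<in> A \<Longrightarrow> a + b \<in> A"
  and subalg_mult: "subalg A \<Longrightarrow> a \<in> A \<Longrightarrow> b \<in> A \<Longrightarrow> a * b \<in> A"
  unfolding subalg_def by auto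

lemma subalg_zero: "subalg A \<Longrightarrow> 0 \<in> A"
  and subalg_one: "subalg A \<Longrightarrow> 1 \<in> A"
  using subalg_const[of A 0] subalg_const[of A 1] by (auto simp: hom_one)

lemma subalg_minus: "subalg A \<Longrightarrow> a \<in> A \<Longrightarrow> - a \<in> A"
  using subalg_mult[OF _ subalg_const[of A "- 1"], of a] by (simp add: hom_minus hom_one)

lemma subalg_diff: "subalg A \<Longrightarrow> a \<in> A \<Longrightarrow> b \<in> A \<Longrightarrow> a - b \<in> A"
  using subalg_add[of A a "- b"] subalg_minus[of A b] by simp

lemma subalg_power: "subalg A \<Longrightarrow> a \<in> A \<Longrightarrow> a ^ n \<in> A"
  by (induction n) (auto intro: subalg_one subalg_mult)

lemma subalg_sum: "subalg A \<Longrightarrow> (\<And>i. i \<in> I \<Longrightarrow> f i \<in> A) \<Longrightarrow> sum f I \<in> A"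
  by (induction I rule: infinite_finite_induct) (auto intro: subalg_zero subalg_add)

lemma subalg_range: "subalg (range \<iota>)"
proof -
  have "\<iota> a + \<iota> b \<in> range \<iota>" "\<iota> a * \<iota> b \<in> range \<iota>" for a b
    using hom_add[of a b] hom_mult[of a b] by (metis rangeI)+
  thus ?thesis unfolding subalg_def by auto
qed

text \<open>The bound \<open>N\<close> is exclusive: it counts the coefficients, and so bounds the
  dimension over \<open>k\<close> when \<open>A\<close> is the image of \<open>k\<close>.\<close>

definition polys_over :: "'f set \<Rightarrow> 'f \<Rightarrow> nat \<Rightarrow> 'f set" where
  "polys_over A x N = {(\<Sum>j<N. c j * x ^ j) | c. \<forall>j. c j \<in> A}"

lemma polys_overI: "(\<And>j. c j \<in> A) \<Longrightarrow> (\<Sum>j<N. c j * x ^ j) \<in> polys_over A x N"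
  unfolding polys_over_def by blast

lemma polys_overE:
  assumes "a \<in> polys_over A x N"
  obtains c where "a = (\<Sum>j<N. c j * x ^ j)" "\<And>j. c j \<in> A"
  using assms unfolding polys_over_def by blast

lemma polys_over_zero: "subalg A \<Longrightarrow> 0 \<in> polys_over A x N"
  using polys_overI[of "\<lambda>_. 0" A x N, OF subalg_zero] by simp

lemma polys_over_add:
  assumes "subalg A" "a \<in> polys_over A x N" "b \<in> polys_over A x N"
  shows "a + b \<in> polys_over A x N"
proof -
  obtain c where c: "a = (\<Sum>j<N. c j * x ^ j)" "\<And>j. c j \<in> A"
    using assms(2) by (rule polys_overE) blast
  obtain d where d: "b = (\<Sum>j<N. d j * x ^ j)" "\<And>j. d j \<in> A"
    using assms(3) by (rule polys_overE) blast
  have "a + b = (\<Sum>j<N. (c j + d j) * x ^ j)"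
    unfolding c d by (simp add: sum.distrib algebra_simps)
  moreover have "c j + d j \<in> A" for j using c d assms(1) subalg_add by blast
  ultimately show ?thesis using polys_overI[of "\<lambda>j. c j + d j"] by metis
qed

lemma polys_over_sum:
  "subalg A \<Longrightarrow> (\<And>i. i \<in> I \<Longrightarrow> f i \<in> polys_over A x N) \<Longrightarrow> sum f I \<in> polys_over A x N"
  by (induction I rule: infinite_finite_induct) (auto intro: polys_over_zero polys_over_add)

lemma polys_over_mono:
  assumes "subalg A" "a \<in> polys_over A x M" "M \<le> N"
  shows "a \<in> polys_over A x N"
proof -
  obtain c where a: "a = (\<Sum>j<M. c j * x ^ j)" "\<And>j. c j \<in> A"
    using assms by (auto elim: polys_overE)
  have "a = (\<Sum>j<N. (if j < M then c j else 0) * x ^ j)"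
    unfolding a using assms(3) by (intro sum.mono_neutral_cong_left) auto
  moreover have "(if j < M then c j else 0) \<in> A" for j by (simp add: a subalg_zero[OF assms(1)])
  ultimately show ?thesis using polys_overI[of "\<lambda>j. if j < M then c j else 0"] by metis
qed

lemma polys_over_monom_mult:
  assumes "subalg A" "e \<in> A" "a \<in> polys_over A x N"
  shows "e * x ^ i * a \<in> polys_over A x (i + N)"
proof -
  obtain c where a: "a = (\<Sum>j<N. c j * x ^ j)" "\<And>j. c j \<in> A"
    using assms by (auto elim: polys_overE)
  have "e * x ^ i * a = (\<Sum>j<N. (e * c j) * x ^ (i + j))"
    unfolding a by (simp add: sum_distrib_left power_add algebra_simps)
  also have "\<dots> = (\<Sum>j\<in>{i..<i+N}. (e * c (j - i)) * x ^ j)"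
    by (rule sum.reindex_bij_witness[of _ "\<lambda>j. j - i" "\<lambda>j. i + j"]) auto
  also have "\<dots> = (\<Sum>j<i+N. (if i \<le> j then e * c (j - i) else 0) * x ^ j)"
    by (intro sum.mono_neutral_cong_left) auto
  also have "\<dots> \<in> polys_over A x (i + N)"
    by (rule polys_overI) (simp add: a assms subalg_zero[OF assms(1)] subalg_mult[OF assms(1)])
  finally show ?thesis .
qed

lemma polys_over_const:
  assumes "subalg A" "e \<in> A" "0 < N"
  shows "e \<in> polys_over A x N"
proof -
  have "e \<in> polys_over A x 1" using polys_overI[of "\<lambda>_. e" A x 1, OF assms(2)] by simp
  thus ?thesis by (rule polys_over_mono[OF assms(1)]) (use assms(3) in simp)
qed

lemma polys_over_monom:
  assumes "subalg A" "e \<in> A" "i < N"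
  shows "e * x ^ i \<in> polys_over A x N"
proof -
  have "1 \<in> polys_over A x 1" by (rule polys_over_const) (use assms subalg_one in auto)
  from polys_over_monom_mult[OF assms(1,2) this, of i] show ?thesis
    using polys_over_mono[OF assms(1), of _ x "i + 1" N] assms(3) by simp
qed

lemma polys_over_mult:
  assumes "subalg A" "a \<in> polys_over A x M" "b \<in> polys_over A x N"
  shows "a * b \<in> polys_over A x (M + N)"
proof -
  obtain c where a: "a = (\<Sum>j<M. c j * x ^ j)" "\<And>j. c j \<in> A"
    using assms by (auto elim: polys_overE)
  have "(\<Sum>j<M. c j * x ^ j * b) \<in> polys_over A x (M + N)"
    by (rule polys_over_sum[OF assms(1)],
        rule polys_over_mono[OF assms(1) polys_over_monom_mult[OF assms(1) a(2) assms(3)]]) simp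
  thus ?thesis by (simp add: a sum_distrib_right)
qed

lemma polys_over_subset:
  assumes "subalg A" "subalg B" "A \<subseteq> B" "x \<in> B"
  shows "polys_over A x N \<subseteq> B"
proof
  fix a assume "a \<in> polys_over A x N"
  then obtain c where "a = (\<Sum>j<N. c j * x ^ j)" "\<And>j. c j \<in> A" by (rule polys_overE) blast
  thus "a \<in> B" using assms by (auto intro!: subalg_sum subalg_mult subalg_power)
qed

lemma subalg_adjoin:
  assumes "subalg A"
  shows "subalg (\<Union>N. polys_over A x N)"
  unfolding subalg_def
proof (intro conjI ballI)
  show "range \<iota> \<subseteq> (\<Union>N. polys_over A x N)"
    using polys_over_const[OF assms subalg_const[OF assms], of 1 _ x] by auto
next
  fix a b assume "a \<in> (\<Union>N. polys_over A x N)" "b \<in> (\<Union>N. polys_over A x N)"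
  then obtain M N where MN: "a \<in> polys_over A x M" "b \<in> polys_over A x N" by blast
  have "a \<in> polys_over A x (M + N)" "b \<in> polys_over A x (M + N)"
    using MN polys_over_mono[OF assms] by auto
  thus "a + b \<in> (\<Union>N. polys_over A x N)" using polys_over_add[OF assms] by blast
  show "a * b \<in> (\<Union>N. polys_over A x N)" using polys_over_mult[OF assms MN] by blast
qed

abbreviation polys :: "'f \<Rightarrow> nat \<Rightarrow> 'f set" where
  "polys \<equiv> polys_over (range \<iota>)"

lemmas polys_zero = polys_over_zero[OF subalg_range]
  and polys_add = polys_over_add[OF subalg_range]
  and polys_mono = polys_over_mono[OF subalg_range]
  and polys_mult = polys_over_mult[OF subalg_range]
  and polys_monom_mult = polys_over_monom_mult[OF subalg_range rangeI]

lemma polysI: "(\<Sum>j<N. \<iota> (c j) * x ^ j) \<in> polys x N"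
  by (rule polys_overI) simp

lemma polysE:
  assumes "a \<in> polys x N"
  obtains c where "a = (\<Sum>j<N. \<iota> (c j) * x ^ j)"
proof -
  obtain c where c: "a = (\<Sum>j<N. c j * x ^ j)" "\<And>j. c j \<in> range \<iota>"
    using assms by (rule polys_overE) blast
  have "\<forall>j. \<exists>d. c j = \<iota> d" using c(2) by blast
  then obtain d where "\<And>j. c j = \<iota> (d j)" by metis
  with c(1) that show ?thesis by simp
qed

lemma polys_one: "0 < N \<Longrightarrow> 1 \<in> polys x N"
  by (rule polys_over_const[OF subalg_range subalg_one[OF subalg_range]])

lemma polys_prod:
  assumes "finite I" "\<And>i. i \<in> I \<Longrightarrow> \<exists>N. f i \<in> polys x N"
  shows "\<exists>N. prod f I \<in> polys x N"
  using assms
proof (induction I rule: finite_induct)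
  case empty
  then show ?case using polys_one[of 1 x] by auto
next
  case (insert i I)
  then obtain M N where "f i \<in> polys x M" "prod f I \<in> polys x N" by (metis insertCI)
  from polys_mult[OF this] show ?case using insert by auto
qed

lemma eval_in_eq: "eval_in \<iota> p x = (\<Sum>j<Suc (degree p). \<iota> (coeff p j) * x ^ j)"
proof -
  have "degree (map_poly \<iota> p) \<le> degree p" by (rule degree_le) (simp add: coeff_map_poly coeff_eq_0)
  hence "eval_in \<iota> p x = (\<Sum>j\<le>degree p. coeff (map_poly \<iota> p) j * x ^ j)"
    unfolding eval_in_def poly_altdef
    by (intro sum.mono_neutral_left) (auto simp: coeff_eq_0)
  thus ?thesis by (simp add: coeff_map_poly lessThan_Suc_atMost)
qed

lemma eval_in_polys: "\<exists>N. eval_in \<iota> p x \<in> polys x N"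
  unfolding eval_in_eq using polysI by blast

section \<open>Lattices over \<open>k[x]\<close> and the pigeonhole principle\<close>

lemma card_image_PiE_le:
  fixes f :: "('i \<Rightarrow> 'k) \<Rightarrow> 'f"
  assumes "finite I"
  shows "finite (f ` (I \<rightarrow>\<^sub>E UNIV)) \<and> card (f ` (I \<rightarrow>\<^sub>E UNIV)) \<le> CARD('k) ^ card I"
  using assms card_image_le[of "I \<rightarrow>\<^sub>E (UNIV :: 'k set)" f] card_PiE[OF assms, of "\<lambda>_. UNIV :: 'k set"]
  by (simp add: finite_PiE)

lemma card_field_gt_1: "1 < CARD('k)"
proof -
  have "card {0, 1 :: 'k} \<le> CARD('k)" by (rule card_mono) auto
  thus ?thesis by simp
qed

text \<open>For \<open>S\<close> generating the field over \<open>k(x)\<close>, a bounded piece of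
  the \<open>k[x]\<close>-module spanned by \<open>S\<close>. As \<open>S\<close> may be dependent,
  only an upper bound for its cardinality is available, which suffices for the pigeonhole
  principle.\<close>

definition lattice :: "'f \<Rightarrow> 'f set \<Rightarrow> nat \<Rightarrow> 'f set" where
  "lattice x S N = {(\<Sum>s\<in>S. g s * s) | g. \<forall>s\<in>S. g s \<in> polys x N}"

lemma lattice_zero: "0 \<in> lattice x S N"
  unfolding lattice_def by (rule CollectI, rule exI[of _ "\<lambda>_. 0"]) (simp add: polys_zero)

lemma lattice_add: "a \<in> lattice x S N \<Longrightarrow> b \<in> lattice x S N \<Longrightarrow> a + b \<in> lattice x S N"
proof -
  assume "a \<in> lattice x S N" "b \<in> lattice x S N"
  then obtain g h where gh: "a = (\<Sum>s\<in>S. g s * s)" "b = (\<Sum>s\<in>S. h s * s)"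
    "\<forall>s\<in>S. g s \<in> polys x N" "\<forall>s\<in>S. h s \<in> polys x N" unfolding lattice_def by blast
  have "a + b = (\<Sum>s\<in>S. (g s + h s) * s)" unfolding gh by (simp add: sum.distrib algebra_simps)
  moreover have "\<forall>s\<in>S. g s + h s \<in> polys x N" using gh polys_add by blast
  ultimately show ?thesis unfolding lattice_def by (auto intro!: exI[of _ "\<lambda>s. g s + h s"])
qed

lemma lattice_sum: "(\<And>i. i \<in> I \<Longrightarrow> f i \<in> lattice x S N) \<Longrightarrow> sum f I \<in> lattice x S N"
  by (induction I rule: infinite_finite_induct) (auto simp: lattice_zero intro: lattice_add)

lemma lattice_polys_mult:
  assumes "a \<in> polys x M" "b \<in> lattice x S N"
  shows "a * b \<in> lattice x S (M + N)"
proof -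
  obtain g where g: "b = (\<Sum>s\<in>S. g s * s)" "\<forall>s\<in>S. g s \<in> polys x N"
    using assms unfolding lattice_def by blast
  have "a * b = (\<Sum>s\<in>S. (a * g s) * s)" unfolding g by (simp add: sum_distrib_left algebra_simps)
  moreover have "\<forall>s\<in>S. a * g s \<in> polys x (M + N)" using g polys_mult[OF assms(1)] by blast
  ultimately show ?thesis unfolding lattice_def by (auto intro!: exI[of _ "\<lambda>s. a * g s"])
qed

lemma lattice_mono: "a \<in> lattice x S M \<Longrightarrow> M \<le> N \<Longrightarrow> a \<in> lattice x S N"
  unfolding lattice_def using polys_mono by blast

lemma lattice_card:
  assumes "finite S"
  shows "finite (lattice x S N)" "card (lattice x S N) \<le> CARD('k) ^ (card S * N)"
proof -
  define f where "f = (\<lambda>c. \<Sum>s\<in>S. (\<Sum>j<N. \<iota> (c (s, j)) * x ^ j) * s)"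
  have "lattice x S N \<subseteq> f ` ((S \<times> {..<N}) \<rightarrow>\<^sub>E UNIV)"
  proof
    fix a assume "a \<in> lattice x S N"
    then obtain g where g: "a = (\<Sum>s\<in>S. g s * s)" "\<forall>s\<in>S. g s \<in> polys x N"
      unfolding lattice_def by blast
    from g(2) have "\<forall>s\<in>S. \<exists>c. g s = (\<Sum>j<N. \<iota> (c j) * x ^ j)" by (metis polysE)
    then obtain c where c: "\<forall>s\<in>S. g s = (\<Sum>j<N. \<iota> (c s j) * x ^ j)" by metis
    have "a = f (restrict (\<lambda>(s, j). c s j) (S \<times> {..<N}))"
      unfolding f_def g(1) using c by (intro sum.cong) auto
    thus "a \<in> f ` ((S \<times> {..<N}) \<rightarrow>\<^sub>E UNIV)" by auto
  qed
  moreover have "finite (f ` ((S \<times> {..<N}) \<rightarrow>\<^sub>E UNIV)) \<and>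
      card (f ` ((S \<times> {..<N}) \<rightarrow>\<^sub>E UNIV)) \<le> CARD('k) ^ card (S \<times> {..<N})"
    by (rule card_image_PiE_le) (use assms in auto)
  ultimately show "finite (lattice x S N)" "card (lattice x S N) \<le> CARD('k) ^ (card S * N)"
    using finite_subset card_mono[of "f ` ((S \<times> {..<N}) \<rightarrow>\<^sub>E UNIV)" "lattice x S N"]
    by (auto simp: card_cartesian_product)
qed

text \<open>Nontriviality is demanded of the coefficients \<open>c i j\<close>, not of the values of
  the polynomials at \<open>y\<close>. For finite \<open>I\<close> and nonconstant \<open>y\<close>
  this is linear dependence over \<open>k(y)\<close>; for constant \<open>y\<close> every nonempty
  family is dependent.\<close>

definition poly_dependent :: "'f \<Rightarrow> 'i set \<Rightarrow> ('i \<Rightarrow> 'f) \<Rightarrow> bool" where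
  "poly_dependent y I z \<longleftrightarrow> (\<exists>N c. (\<exists>i\<in>I. \<exists>j<N. c i j \<noteq> 0) \<and>
     (\<Sum>i\<in>I. (\<Sum>j<N. \<iota> (c i j) * y ^ j) * z i) = 0)"

text \<open>Clears the denominators of the coordinates of finitely many elements with respect to
  \<open>S\<close>. Multiplying by one more denominator keeps the earlier elements in a lattice,
  with a larger degree bound.\<close>

lemma common_denominator:
  assumes fin: "finite S"
    and gen: "\<forall>f. \<exists>c. (\<forall>s\<in>S. c s \<in> simple_extension \<iota> x) \<and> f = (\<Sum>s\<in>S. c s * s)"
    and "finite I"
  shows "\<exists>d M N. d \<noteq> 0 \<and> d \<in> polys x M \<and> (\<forall>i\<in>I. d * z i \<in> lattice x S N)"
  using \<open>finite I\<close>
proof (induction I rule: finite_induct)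
  case empty
  then show ?case using polys_one[of 1 x] by (intro exI[of _ 1]) auto
next
  case (insert i I)
  then obtain d M N where d: "d \<noteq> 0" "d \<in> polys x M" "\<forall>i\<in>I. d * z i \<in> lattice x S N" by blast
  obtain c where c: "\<forall>s\<in>S. c s \<in> simple_extension \<iota> x" "z i = (\<Sum>s\<in>S. c s * s)"
    using gen by blast
  have "\<forall>s\<in>S. \<exists>p q. c s = eval_in \<iota> p x / eval_in \<iota> q x \<and> eval_in \<iota> q x \<noteq> 0"
    using c(1) unfolding simple_extension_def by blast
  then obtain p q where pq: "\<forall>s\<in>S. c s = eval_in \<iota> (p s) x / eval_in \<iota> (q s) x \<and> eval_in \<iota> (q s) x \<noteq> 0"
    by metis
  define e where "e = (\<Prod>s\<in>S. eval_in \<iota> (q s) x)"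
  have e0: "e \<noteq> 0" unfolding e_def using pq fin by auto
  obtain E where E: "e \<in> polys x E" unfolding e_def using polys_prod[OF fin, of "\<lambda>s. eval_in \<iota> (q s) x"] eval_in_polys by blast
  have "\<exists>L. e * c s \<in> polys x L" if s: "s \<in> S" for s
  proof -
    have "e * c s = eval_in \<iota> (p s) x * (\<Prod>s\<in>S-{s}. eval_in \<iota> (q s) x)"
      unfolding e_def using prod.remove[OF fin s, of "\<lambda>s. eval_in \<iota> (q s) x"] pq s by simp
    moreover obtain A where "eval_in \<iota> (p s) x \<in> polys x A" using eval_in_polys by blast
    moreover obtain B where "(\<Prod>s\<in>S-{s}. eval_in \<iota> (q s) x) \<in> polys x B"
      using polys_prod[of "S - {s}" "\<lambda>s. eval_in \<iota> (q s) x"] fin eval_in_polys by blast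
    ultimately show ?thesis using polys_mult by metis
  qed
  then obtain L where L: "\<forall>s\<in>S. e * c s \<in> polys x (L s)" by metis
  define K where "K = (\<Sum>s\<in>S. L s)"
  have K: "e * c s \<in> polys x K" if "s \<in> S" for s
    using L that polys_mono[of _ x "L s" K] member_le_sum[of s S L] fin unfolding K_def by auto
  have ez: "e * z i \<in> lattice x S K"
    unfolding lattice_def using K c(2)
    by (auto intro!: exI[of _ "\<lambda>s. e * c s"] simp: sum_distrib_left algebra_simps)
  have 1: "e * d \<noteq> 0" "e * d \<in> polys x (E + M)" using e0 d polys_mult[OF E] by auto
  have 2: "e * d * z j \<in> lattice x S (E + M + K + N)" if j: "j \<in> insert i I" for j
  proof (cases "j = i")
    case True
    have "d * (e * z i) \<in> lattice x S (M + K)" by (rule lattice_polys_mult[OF d(2) ez])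
    thus ?thesis using lattice_mono[of _ x S "M + K" "E + M + K + N"] True by (simp add: algebra_simps)
  next
    case False
    have "e * (d * z j) \<in> lattice x S (E + N)"
      by (rule lattice_polys_mult[OF E]) (use j d False in auto)
    thus ?thesis using lattice_mono[of _ x S "E + N" "E + M + K + N"] by (simp add: algebra_simps)
  qed
  show ?case using 1 2 by blast
qed

text \<open>
  Up to a common denominator, the monomials \<open>y ^ j\<close> with \<open>j < N\<close> stay in a space of dimension
  linear in \<open>N\<close> with a slope depending on \<open>y\<close> only, so the pigeonhole principle produces relations.
\<close>

lemma ex_rank_bound: "\<exists>m. \<forall>z :: nat \<Rightarrow> 'f. poly_dependent y {..m} z"
proof -
  obtain x S where fin: "finite S"
    and gen: "\<forall>f. \<exists>c. (\<forall>s\<in>S. c s \<in> simple_extension \<iota> x) \<and> f = (\<Sum>s\<in>S. c s * s)"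
    using finite_over_rational by blast
  obtain d M L where d: "d \<noteq> 0" "d \<in> polys x M" "\<forall>s\<in>S. d * (y * s) \<in> lattice x S L"
    using common_denominator[OF fin gen fin, of "\<lambda>s. y * s"] by blast
  \<comment> \<open>A common cost \<open>a\<close> for multiplying by \<open>d\<close> and by
    \<open>d * y\<close> makes the total cost of \<open>d ^ N * y ^ j\<close> independent of
    \<open>j \<le> N\<close>.\<close>
  define a where "a = M + L"
  have da: "d \<in> polys x a" using d polys_mono[of d x M a] unfolding a_def by simp
  have dl: "d * v \<in> lattice x S (a + e)" if "v \<in> lattice x S e" for v e
    by (rule lattice_polys_mult[OF da that])
  have dy: "d * y * v \<in> lattice x S (a + e)" if v: "v \<in> lattice x S e" for v e
  proof -
    obtain g where g: "v = (\<Sum>s\<in>S. g s * s)" "\<forall>s\<in>S. g s \<in> polys x e"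
      using v unfolding lattice_def by blast
    have "(\<Sum>s\<in>S. g s * (d * (y * s))) \<in> lattice x S (a + e)"
    proof (rule lattice_sum)
      fix s assume s: "s \<in> S"
      have "g s * (d * (y * s)) \<in> lattice x S (e + L)"
        by (rule lattice_polys_mult) (use g d s in auto)
      thus "g s * (d * (y * s)) \<in> lattice x S (a + e)"
        by (rule lattice_mono) (simp add: a_def)
    qed
    thus ?thesis unfolding g by (simp add: sum_distrib_left algebra_simps)
  qed
  have dn: "d ^ n * v \<in> lattice x S (n * a + e)" if "v \<in> lattice x S e" for n v e
  proof (induction n)
    case (Suc n)
    from dl[OF this] show ?case by (simp add: algebra_simps)
  qed (use that in simp)
  have dyn: "d ^ j * y ^ j * v \<in> lattice x S (j * a + e)" if "v \<in> lattice x S e" for j v e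
  proof (induction j)
    case (Suc j)
    from dy[OF this] show ?case by (simp add: algebra_simps)
  qed (use that in simp)
  have dN: "d ^ N * y ^ j * v \<in> lattice x S (N * a + e)" if "v \<in> lattice x S e" "j \<le> N" for N j v e
  proof -
    have "d ^ (N - j) * (d ^ j * y ^ j * v) \<in> lattice x S ((N - j) * a + (j * a + e))"
      by (rule dn[OF dyn[OF that(1)]])
    moreover have "(N - j) * a + (j * a + e) = N * a + e"
      using that(2) by (metis add.assoc le_add_diff_inverse2 distrib_right)
    moreover have "d ^ (N - j) * (d ^ j * y ^ j * v) = d ^ N * y ^ j * v"
      using that(2) by (simp add: mult.assoc[symmetric] power_add[symmetric])
    ultimately show ?thesis by simp
  qed
  \<comment> \<open>Each unit of \<open>N\<close> adds \<open>card S * a\<close> to the bound on the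
    dimension of the target lattice, so \<open>m + 1\<close> elements, with \<open>m + 1\<close>
    more coefficients per unit, eventually win.\<close>
  define m where "m = card S * a"
  have "poly_dependent y {..m} z" for z :: "nat \<Rightarrow> 'f"
  proof -
    obtain D M' b where D: "D \<noteq> 0" "D \<in> polys x M'" "\<forall>i\<in>{..m}. D * z i \<in> lattice x S b"
      using common_denominator[OF fin gen, of "{..m}" z] by blast
    \<comment> \<open>\<open>(m + 1) * N = card S * a * N + N\<close> has to exceed
      \<open>card S * (N * a + b)\<close>, that is, \<open>N > card S * b\<close>.\<close>
    define N where "N = Suc (card S * b)"
    define \<phi> where "\<phi> = (\<lambda>c. \<Sum>i\<in>{..m}. (\<Sum>j<N. \<iota> (c (i, j)) * y ^ j) * z i)"
    define T where "T = (({..m} \<times> {..<N}) \<rightarrow>\<^sub>E (UNIV :: 'k set))"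
    have sub: "(\<lambda>c. D * d ^ N * \<phi> c) ` T \<subseteq> lattice x S (N * a + b)"
    proof (rule image_subsetI)
      fix c
      have 1: "\<iota> (c (i, j)) * (d ^ N * y ^ j * (D * z i)) \<in> lattice x S (N * a + b)"
        if "i \<in> {..m}" "j < N" for i j
      proof -
        have "d ^ N * y ^ j * (D * z i) \<in> lattice x S (N * a + b)"
          by (rule dN) (use that D in auto)
        then obtain g where g: "d ^ N * y ^ j * (D * z i) = (\<Sum>s\<in>S. g s * s)"
          "\<forall>s\<in>S. g s \<in> polys x (N * a + b)" unfolding lattice_def by blast
        have "\<forall>s\<in>S. \<iota> (c (i, j)) * g s \<in> polys x (N * a + b)"
          using g(2) polys_monom_mult[of _ x "N * a + b" "c (i, j)" 0] by auto
        thus ?thesis unfolding g lattice_def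
          by (auto intro!: exI[of _ "\<lambda>s. \<iota> (c (i, j)) * g s"] simp: sum_distrib_left algebra_simps)
      qed
      have "D * d ^ N * \<phi> c = (\<Sum>i\<in>{..m}. \<Sum>j<N. \<iota> (c (i, j)) * (d ^ N * y ^ j * (D * z i)))"
        unfolding \<phi>_def by (simp add: sum_distrib_left sum_distrib_right algebra_simps)
      thus "D * d ^ N * \<phi> c \<in> lattice x S (N * a + b)"
        using 1 by (auto intro!: lattice_sum)
    qed
    have "card T = CARD('k) ^ (Suc m * N)"
      unfolding T_def by (subst card_PiE) (auto simp: card_cartesian_product)
    moreover have "card ((\<lambda>c. D * d ^ N * \<phi> c) ` T) \<le> CARD('k) ^ (card S * (N * a + b))"
      using card_mono[OF lattice_card(1)[OF fin] sub] lattice_card(2)[OF fin] le_trans by blast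
    moreover have "card S * (N * a + b) < Suc m * N"
      unfolding m_def N_def by (simp add: algebra_simps)
    hence "CARD('k) ^ (card S * (N * a + b)) < CARD('k) ^ (Suc m * N)"
      using card_field_gt_1 by (intro power_strict_increasing) auto
    ultimately have "\<not> inj_on (\<lambda>c. D * d ^ N * \<phi> c) T" using card_image by fastforce
    then obtain c c' where cc: "c \<in> T" "c' \<in> T" "c \<noteq> c'" "D * d ^ N * \<phi> c = D * d ^ N * \<phi> c'"
      unfolding inj_on_def by blast
    have eq: "\<phi> c = \<phi> c'" using cc(4) D(1) d(1) by simp
    have "\<exists>i\<in>{..m}. \<exists>j<N. c (i, j) \<noteq> c' (i, j)"
    proof (rule ccontr)
      assume "\<not> ?thesis"
      hence "c = c'" using cc(1,2) unfolding T_def by (intro PiE_ext[of c _ _ c']) auto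
      with cc(3) show False by simp
    qed
    moreover have "(\<Sum>i\<in>{..m}. (\<Sum>j<N. \<iota> (c (i, j) - c' (i, j)) * y ^ j) * z i) = \<phi> c - \<phi> c'"
      unfolding \<phi>_def by (simp add: hom_diff left_diff_distrib sum_subtractf)
    ultimately show ?thesis unfolding poly_dependent_def using eq
      by (intro exI[of _ N] exI[of _ "\<lambda>i j. c (i, j) - c' (i, j)"]) auto
  qed
  thus ?thesis by blast
qed

lemma dep_reindex:
  fixes z :: "'i \<Rightarrow> 'f"
  assumes "\<forall>z :: nat \<Rightarrow> 'f. poly_dependent y {..m} z" "finite I" "m < card I"
  shows "poly_dependent y I z"
proof -
  obtain f where f: "inj_on f {..m}" "f ` {..m} \<subseteq> I"
    using card_le_inj[of "{..m}" I] assms by auto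
  obtain N c where c: "\<exists>i\<le>m. \<exists>j<N. c i j \<noteq> 0"
    "(\<Sum>i\<le>m. (\<Sum>j<N. \<iota> (c i j) * y ^ j) * z (f i)) = 0"
    using assms(1)[rule_format, of "\<lambda>i. z (f i)"] unfolding poly_dependent_def by auto
  define c' where "c' = (\<lambda>i. if i \<in> f ` {..m} then c (inv_into {..m} f i) else (\<lambda>_. 0))"
  have c': "c' (f i) = c i" if "i \<le> m" for i
    unfolding c'_def using that f(1) by simp
  have "(\<Sum>i\<in>I. (\<Sum>j<N. \<iota> (c' i j) * y ^ j) * z i)
      = (\<Sum>i\<in>f ` {..m}. (\<Sum>j<N. \<iota> (c' i j) * y ^ j) * z i)"
    using assms(2) f(2) by (intro sum.mono_neutral_right) (auto simp: c'_def)
  also have "\<dots> = (\<Sum>i\<le>m. (\<Sum>j<N. \<iota> (c i j) * y ^ j) * z (f i))"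
    by (subst sum.reindex[OF f(1)]) (simp add: c')
  finally have "(\<Sum>i\<in>I. (\<Sum>j<N. \<iota> (c' i j) * y ^ j) * z i) = 0" using c(2) by simp
  moreover have "\<exists>i\<in>I. \<exists>j<N. c' i j \<noteq> 0"
  proof -
    obtain i j where "i \<le> m" "j < N" "c i j \<noteq> 0" using c(1) by blast
    thus ?thesis using c'[of i] f(2) by (intro bexI[of _ "f i"] exI[of _ j]) auto
  qed
  ultimately show ?thesis unfolding poly_dependent_def by blast
qed

text \<open>Dividing by the largest power of \<open>y\<close> common to all coefficients leaves a
  relation that is still nontrivial modulo \<open>y\<close>. Where \<open>y\<close> has positive
  value, its reduction is a nontrivial relation over \<open>k\<close>; the independence arguments at
  a valuation all use this.\<close>

lemma dep_normal_form:
  fixes z :: "'i \<Rightarrow> 'f"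
  assumes "poly_dependent y I z" "y \<noteq> 0"
  obtains a w N where "\<exists>i\<in>I. a i \<noteq> 0" "\<And>i. w i \<in> polys y N"
    "(\<Sum>i\<in>I. (\<iota> (a i) + y * w i) * z i) = 0"
proof -
  obtain N c where c: "\<exists>i\<in>I. \<exists>j<N. c i j \<noteq> 0"
    "(\<Sum>i\<in>I. (\<Sum>j<N. \<iota> (c i j) * y ^ j) * z i) = 0"
    using assms(1) unfolding poly_dependent_def by blast
  define l where "l = (LEAST j. j < N \<and> (\<exists>i\<in>I. c i j \<noteq> 0))"
  have l: "l < N \<and> (\<exists>i\<in>I. c i l \<noteq> 0)" unfolding l_def by (rule LeastI_ex) (use c in blast)
  have below: "c i j = 0" if "j < l" "i \<in> I" for i j
    using not_less_Least[of j "\<lambda>j. j < N \<and> (\<exists>i\<in>I. c i j \<noteq> 0)"] that l unfolding l_def by force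
  define w where "w = (\<lambda>i. \<Sum>j<N - Suc l. \<iota> (c i (Suc l + j)) * y ^ j)"
  have eq: "(\<Sum>j<N. \<iota> (c i j) * y ^ j) = y ^ l * (\<iota> (c i l) + y * w i)" if "i \<in> I" for i
  proof -
    have "(\<Sum>j<N. \<iota> (c i j) * y ^ j) = (\<Sum>j\<in>{l..<N}. \<iota> (c i j) * y ^ j)"
      by (rule sum.mono_neutral_right) (use below that in \<open>auto simp: not_le\<close>)
    also have "{l..<N} = insert l {Suc l..<N}" using l by auto
    also have "(\<Sum>j\<in>insert l {Suc l..<N}. \<iota> (c i j) * y ^ j)
      = \<iota> (c i l) * y ^ l + (\<Sum>j\<in>{Suc l..<N}. \<iota> (c i j) * y ^ j)" by simp
    also have "(\<Sum>j\<in>{Suc l..<N}. \<iota> (c i j) * y ^ j)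
      = (\<Sum>j<N - Suc l. \<iota> (c i (Suc l + j)) * y ^ (Suc l + j))"
      by (rule sum.reindex_bij_witness[of _ "\<lambda>j. Suc l + j" "\<lambda>j. j - Suc l"]) auto
    also have "\<dots> = y ^ l * (y * w i)"
      unfolding w_def by (simp add: sum_distrib_left power_add algebra_simps)
    finally show ?thesis by (simp add: algebra_simps)
  qed
  have "y ^ l * (\<Sum>i\<in>I. (\<iota> (c i l) + y * w i) * z i)
    = (\<Sum>i\<in>I. (\<Sum>j<N. \<iota> (c i j) * y ^ j) * z i)"
    unfolding sum_distrib_left by (rule sum.cong) (simp_all add: eq)
  hence "(\<Sum>i\<in>I. (\<iota> (c i l) + y * w i) * z i) = 0" using c(2) assms(2) by simp
  moreover have "w i \<in> polys y (N - Suc l)" for i unfolding w_def by (rule polysI)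
  ultimately show ?thesis using that[of "\<lambda>i. c i l" w "N - Suc l"] l by blast
qed

section \<open>Every nonconstant function has a pole\<close>

lemma eval_in_eq_sum:
  assumes "degree p < N"
  shows "eval_in \<iota> p x = (\<Sum>j<N. \<iota> (coeff p j) * x ^ j)"
  unfolding eval_in_eq using assms
  by (intro sum.mono_neutral_left) (auto simp: coeff_eq_0)

lemma nonconstant_independent:
  assumes "y \<notin> range \<iota>" "(\<Sum>j<N. \<iota> (c j) * y ^ j) = 0" "j < N"
  shows "c j = 0"
proof (rule ccontr)
  assume nz: "c j \<noteq> 0"
  define p where "p = (\<Sum>i<N. monom (c i) i)"
  have co: "coeff p i = (if i < N then c i else 0)" for i
    unfolding p_def by (auto simp: coeff_sum)
  have "p \<noteq> 0" using co[of j] assms(3) nz by auto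
  moreover have "degree p < N"
  proof -
    have "degree p \<le> N - 1" by (rule degree_le) (use assms(3) in \<open>auto simp: co\<close>)
    thus ?thesis using assms(3) by simp
  qed
  hence "eval_in \<iota> p y = 0" using assms(2) by (simp add: eval_in_eq_sum co)
  ultimately show False using assms(1) constants_closed unfolding algebraic_over_def by blast
qed

text \<open>Multiplying \<open>y = p(1/y)\<close> by \<open>y ^ N\<close> gives a monic equation of
  degree \<open>N + 1\<close>, so \<open>y\<close> would be algebraic and hence constant. This
  supplies the ring from which Zorn's lemma starts.\<close>

lemma nonconstant_not_poly_in_inverse:
  assumes "y \<notin> range \<iota>"
  shows "y \<notin> polys (inverse y) N"
proof
  assume "y \<in> polys (inverse y) N"
  then obtain c where c: "y = (\<Sum>j<N. \<iota> (c j) * inverse y ^ j)" by (rule polysE)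
  have y0: "y \<noteq> 0" using assms hom_zero by (metis rangeI)
  define d where "d = (\<lambda>i. if i = Suc N then 1 else if i = 0 then 0 else - c (N - i))"
  have "y ^ Suc N = (\<Sum>j<N. \<iota> (c j) * y ^ (N - j))"
  proof -
    have "y ^ Suc N = y ^ N * (\<Sum>j<N. \<iota> (c j) * inverse y ^ j)" using c by simp
    also have "\<dots> = (\<Sum>j<N. \<iota> (c j) * y ^ (N - j))"
      unfolding sum_distrib_left
      by (rule sum.cong) (use y0 in \<open>auto simp: power_diff power_inverse divide_inverse\<close>)
    finally show ?thesis .
  qed
  also have "\<dots> = (\<Sum>i\<in>{1..N}. \<iota> (c (N - i)) * y ^ i)"
    by (rule sum.reindex_bij_witness[of _ "\<lambda>i. N - i" "\<lambda>j. N - j"]) auto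
  also have "\<dots> = - (\<Sum>i\<in>{1..N}. \<iota> (d i) * y ^ i)"
    unfolding sum_negf[symmetric] by (rule sum.cong) (auto simp: d_def hom_minus)
  finally have "(\<Sum>i\<in>{1..N}. \<iota> (d i) * y ^ i) + y ^ Suc N = 0" by (simp only: ab_left_minus add.right_inverse)
  moreover have "(\<Sum>i<Suc (Suc N). \<iota> (d i) * y ^ i) = (\<Sum>i\<in>{1..N}. \<iota> (d i) * y ^ i) + y ^ Suc N"
  proof -
    have "(\<Sum>i<Suc N. \<iota> (d i) * y ^ i) = (\<Sum>i\<in>{1..N}. \<iota> (d i) * y ^ i)"
      by (rule sum.mono_neutral_right) (auto simp: d_def)
    moreover have "\<iota> (d (Suc N)) = 1" by (simp add: d_def hom_one)
    ultimately show ?thesis by simp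
  qed
  ultimately have "(\<Sum>i<Suc (Suc N). \<iota> (d i) * y ^ i) = 0" by simp
  from nonconstant_independent[OF assms this, of "Suc N"] show False by (simp add: d_def)
qed

text \<open>
  Degree reduction in Chevalley's extension argument: eliminate the leading term of the
  relation for \<open>z\<close> by means of the relation for \<open>inverse z\<close>.
\<close>

lemma valuation_ring_step:
  assumes R: "subalg R" "u \<in> R" and "z \<noteq> 0"
    and p: "p \<in> polys_over R z (Suc n)" "1 = u * p"
    and q: "q \<in> polys_over R (inverse z) (Suc m)" "1 = u * q"
    and mn: "m \<le> n" "0 < m"
  shows "\<exists>p'\<in>polys_over R z n. 1 = u * p'"
proof -
  obtain a where a: "p = (\<Sum>j<Suc n. a j * z ^ j)" "\<And>j. a j \<in> R" using p(1) by (rule polys_overE) blast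
  obtain b where b: "q = (\<Sum>j<Suc m. b j * inverse z ^ j)" "\<And>j. b j \<in> R"
    using q(1) by (rule polys_overE) blast
  define p0 where "p0 = (\<Sum>j<n. a j * z ^ j)"
  define q0 where "q0 = (\<Sum>j<m. b (Suc j) * inverse z ^ Suc j)"
  define r where "r = (\<Sum>j<m. b (Suc j) * z ^ (n - Suc j))"
  have p0: "p0 \<in> polys_over R z n" unfolding p0_def by (rule polys_overI) (rule a)
  have r: "r \<in> polys_over R z n" unfolding r_def
    by (rule polys_over_sum[OF R(1)], rule polys_over_monom[OF R(1) b(2)]) (use mn in auto)
  have zr: "z ^ n * q0 = r" unfolding q0_def r_def sum_distrib_left
    by (rule sum.cong) (use mn \<open>z \<noteq> 0\<close> in \<open>auto simp: power_diff power_inverse field_simps\<close>)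
  have peq: "p = p0 + a n * z ^ n" unfolding a p0_def by simp
  have qeq: "q = b 0 + q0" unfolding b q0_def by (subst sum.lessThan_Suc_shift) simp
  \<comment> \<open>Multiply \<open>1 = u * p\<close> by \<open>1 - u * b 0 = u * q0\<close>. In the
    leading term, \<open>z ^ n * q0 = r\<close> has degree below \<open>n\<close>; adding
    \<open>u * b 0\<close> back restores the 1.\<close>
  define p' where "p' = b 0 + (1 - u * b 0) * p0 + (u * a n) * r"
  have "p' \<in> polys_over R z n"
  proof -
    have "b 0 \<in> polys_over R z n" by (rule polys_over_const[OF R(1) b(2)]) (use mn in simp)
    moreover have "(1 - u * b 0) * p0 \<in> polys_over R z n"
      using polys_over_monom_mult[OF R(1) _ p0, of "1 - u * b 0" 0] R b
      by (simp add: subalg_diff subalg_one subalg_mult)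
    moreover have "(u * a n) * r \<in> polys_over R z n"
      using polys_over_monom_mult[OF R(1) _ r, of "u * a n" 0] R a
      by (simp add: subalg_mult)
    ultimately show ?thesis unfolding p'_def by (intro polys_over_add[OF R(1)])
  qed
  moreover have "1 = u * p'"
  proof -
    have 1: "1 - u * b 0 = u * q0" using q(2) qeq by (simp add: algebra_simps)
    have "u * p' = u * b 0 + (1 - u * b 0) * (u * p0) + u * a n * (z ^ n * (u * q0))"
      unfolding p'_def zr[symmetric] by (simp add: algebra_simps)
    also have "\<dots> = u * b 0 + (1 - u * b 0) * (u * p)"
      unfolding 1[symmetric] peq by (simp add: algebra_simps)
    finally show ?thesis using p(2) by simp
  qed
  ultimately show ?thesis by blast
qed

text \<open>Descent on the sum of the degrees of two representations of 1, one in
  \<open>u R[z]\<close> and one in \<open>u R[1/z]\<close>: the larger degree can be lowered until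
  one representation lies in \<open>u R\<close>, which does not contain 1.\<close>

lemma valuation_ring_aux:
  assumes R: "subalg R" "u \<in> R" "\<And>a. a \<in> R \<Longrightarrow> 1 \<noteq> u * a"
  shows "z \<noteq> 0 \<Longrightarrow> p \<in> polys_over R z (Suc n) \<Longrightarrow> 1 = u * p \<Longrightarrow>
    q \<in> polys_over R (inverse z) (Suc m) \<Longrightarrow> 1 = u * q \<Longrightarrow> False"
proof (induction "n + m" arbitrary: n m z p q rule: less_induct)
  case less
  have c: "a \<in> R" if "a \<in> polys_over R w (Suc 0)" for a w
    using that by (auto elim!: polys_overE)
  show ?case
  proof (cases "n = 0 \<or> m = 0")
    case True
    thus ?thesis using c less.prems R(3) by blast
  next
    case False
    show ?thesis
    proof (cases "m \<le> n")
      case True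
      obtain p' where "p' \<in> polys_over R z n" "1 = u * p'"
        using valuation_ring_step[OF R(1,2) less.prems(1-5) True] False by auto
      thus ?thesis using less.hyps[of "n - 1" m z p' q] less.prems False by simp
    next
      case F: False
      obtain q' where "q' \<in> polys_over R (inverse z) m" "1 = u * q'"
        using valuation_ring_step[OF R(1,2), of "inverse z" q m p n] less.prems False F by auto
      thus ?thesis using less.hyps[of n "m - 1" z p q'] less.prems False by simp
    qed
  qed
qed

text \<open>Zorn's lemma among the subalgebras containing \<open>1/y\<close> but not
  \<open>y\<close>, starting from \<open>k[1/y]\<close>. If neither \<open>z\<close> nor
  \<open>1/z\<close> were in a maximal \<open>R\<close>, adjoining either would capture
  \<open>y\<close> and so put 1 into both \<open>(1/y) R[z]\<close> and \<open>(1/y) R[1/z]\<close>,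
  which the descent excludes.\<close>

lemma ex_valuation_ring:
  assumes y: "y \<notin> range \<iota>"
  obtains R where "subalg R" "y \<notin> R" "inverse y \<in> R" "\<And>z. z \<in> R \<or> inverse z \<in> R"
proof -
  define \<A> where "\<A> = {R. subalg R \<and> inverse y \<in> R \<and> y \<notin> R}"
  have y0: "y \<noteq> 0" using assms hom_zero by (metis rangeI)
  have "(\<Union>N. polys (inverse y) N) \<in> \<A>"
  proof -
    have "1 * inverse y ^ 1 \<in> polys (inverse y) 2"
      by (rule polys_over_monom[OF subalg_range]) (simp_all add: subalg_one[OF subalg_range])
    thus ?thesis unfolding \<A>_def
      using subalg_adjoin[OF subalg_range] nonconstant_not_poly_in_inverse[OF y] by auto
  qed
  hence ne: "\<A> \<noteq> {}" by blast
  have "\<exists>M\<in>\<A>. \<forall>X\<in>\<A>. M \<subseteq> X \<longrightarrow> X = M"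
  proof (rule subset_Zorn_nonempty[OF ne])
    fix \<C> assume C: "\<C> \<noteq> {}" "subset.chain \<A> \<C>"
    hence sub: "\<C> \<subseteq> \<A>" and lin: "\<And>X Y. X \<in> \<C> \<Longrightarrow> Y \<in> \<C> \<Longrightarrow> X \<subseteq> Y \<or> Y \<subseteq> X"
      unfolding subset.chain_def by auto
    have "subalg (\<Union>\<C>)" unfolding subalg_def
    proof (intro conjI ballI)
      show "range \<iota> \<subseteq> \<Union>\<C>" using C(1) sub unfolding \<A>_def subalg_def by blast
    next
      fix a b assume "a \<in> \<Union>\<C>" "b \<in> \<Union>\<C>"
      then obtain X where "X \<in> \<C>" "a \<in> X" "b \<in> X" using lin by blast
      moreover have "subalg X" using \<open>X \<in> \<C>\<close> sub unfolding \<A>_def by blast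
      ultimately show "a + b \<in> \<Union>\<C>" "a * b \<in> \<Union>\<C>" using subalg_add subalg_mult by blast+
    qed
    thus "\<Union>\<C> \<in> \<A>" using C(1) sub unfolding \<A>_def by blast
  qed
  then obtain R where R: "R \<in> \<A>" and max: "\<And>X. X \<in> \<A> \<Longrightarrow> R \<subseteq> X \<Longrightarrow> X = R" by blast
  have R': "subalg R" "inverse y \<in> R" "y \<notin> R" using R unfolding \<A>_def by auto
  have adj: "\<exists>n p. p \<in> polys_over R z (Suc n) \<and> 1 = inverse y * p" if z: "z \<notin> R" for z
  proof -
    define X where "X = (\<Union>N. polys_over R z N)"
    have "R \<subseteq> X" unfolding X_def using polys_over_const[OF R'(1), of _ 1] by auto
    moreover have "z \<in> X"
      using polys_over_monom[OF R'(1) subalg_one[OF R'(1)], of 1 2 z] unfolding X_def by auto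
    moreover have "subalg X" unfolding X_def by (rule subalg_adjoin[OF R'(1)])
    ultimately have "y \<in> X" using max[of X] z R' unfolding \<A>_def by blast
    then obtain N where "y \<in> polys_over R z N" unfolding X_def by blast
    hence "y \<in> polys_over R z (Suc N)" using polys_over_mono[OF R'(1)] by auto
    thus ?thesis using y0 by (intro exI[of _ N] exI[of _ y]) simp
  qed
  have nu: "1 \<noteq> inverse y * a" if "a \<in> R" for a
  proof
    assume "1 = inverse y * a"
    hence "a = y" using y0 by (simp add: field_simps)
    thus False using that R'(3) by simp
  qed
  have "z \<in> R \<or> inverse z \<in> R" for z
  proof (rule ccontr)
    assume "\<not> (z \<in> R \<or> inverse z \<in> R)"
    moreover from this have "z \<noteq> 0" using subalg_zero[OF R'(1)] by auto
    ultimately show False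
      using adj[of z] adj[of "inverse z"] valuation_ring_aux[OF R'(1,2) nu] by blast
  qed
  thus ?thesis using that R' by blast
qed

end

section \<open>Discreteness of valuation rings\<close>

locale valuation_ring = function_field \<iota>
  for \<iota> :: "'k::{field,finite} \<Rightarrow> 'f::field" +
  fixes R :: "'f set"
  assumes subalg: "subalg R"
    and total: "z \<in> R \<or> inverse z \<in> R"
    and proper: "R \<noteq> UNIV"
begin

lemmas R_const = subalg_const[OF subalg] and R_add = subalg_add[OF subalg]
  and R_mult = subalg_mult[OF subalg] and R_zero = subalg_zero[OF subalg]
  and R_one = subalg_one[OF subalg] and R_minus = subalg_minus[OF subalg]
  and R_power = subalg_power[OF subalg]

text \<open>The nonunits of \<open>R\<close>, which form its maximal ideal.\<close>

definition M :: "'f set" where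
  "M = {z \<in> R. z = 0 \<or> inverse z \<notin> R}"

lemma M_in_R: "a \<in> M \<Longrightarrow> a \<in> R"
  unfolding M_def by simp

lemma zero_in_M: "0 \<in> M"
  unfolding M_def using R_zero by simp

lemma M_mult:
  assumes "a \<in> R" "b \<in> M"
  shows "a * b \<in> M"
proof (cases "a * b = 0")
  case False
  have "inverse (a * b) \<notin> R"
  proof
    assume "inverse (a * b) \<in> R"
    from R_mult[OF assms(1) this] have "inverse b \<in> R" using False by (simp add: field_simps)
    thus False using assms False unfolding M_def by auto
  qed
  thus ?thesis using assms R_mult unfolding M_def by auto
qed (use zero_in_M in auto)

lemma M_add:
  assumes "a \<in> M" "b \<in> M"
  shows "a + b \<in> M"
proof -
  have *: "a + b \<in> M" if "a \<in> M" "b \<in> M" "a * inverse b \<in> R" "b \<noteq> 0" for a b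
  proof -
    have "(1 + a * inverse b) * b \<in> M" using that R_one R_add by (intro M_mult) auto
    thus ?thesis using that(4) by (simp add: distrib_right mult.assoc add.commute)
  qed
  consider "a = 0" | "b = 0" | "a \<noteq> 0" "b \<noteq> 0" "a * inverse b \<in> R"
    | "a \<noteq> 0" "b \<noteq> 0" "b * inverse a \<in> R"
    using total[of "a * inverse b"] by (auto simp: field_simps)
  thus ?thesis using *[of a b] *[of b a] assms by cases (auto simp: add.commute)
qed

lemma M_sum: "(\<And>i. i \<in> I \<Longrightarrow> f i \<in> M) \<Longrightarrow> sum f I \<in> M"
  by (induction I rule: infinite_finite_induct) (auto intro: zero_in_M M_add)

lemma M_minus: "a \<in> M \<Longrightarrow> - a \<in> M"
  using M_mult[OF R_minus[OF R_one], of a] by simp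

lemma const_notin_M: "c \<noteq> 0 \<Longrightarrow> \<iota> c \<notin> M"
  unfolding M_def using R_const by (auto simp flip: hom_inverse)

lemma not_in_R_inverse_in_M: "z \<notin> R \<Longrightarrow> inverse z \<in> M"
  unfolding M_def using total[of z] by auto

text \<open>The principal ideals of the \<open>x i\<close> increase strictly. In a relation reduced
  modulo \<open>x 0\<close>, let \<open>j\<close> be the last index with nonzero constant term and
  divide by \<open>x j\<close>. Earlier terms lie in \<open>M\<close> because
  \<open>x i / x j\<close> does, later ones because their coefficient is a multiple of
  \<open>x 0\<close>. So a nonzero constant would lie in \<open>M\<close>.\<close>

lemma chain_not_dep:
  fixes x :: "nat \<Rightarrow> 'f"
  assumes "\<And>i. i \<le> n \<Longrightarrow> x i \<in> M \<and> x i \<noteq> 0"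
    and step: "\<And>i. i < n \<Longrightarrow> x i / x (Suc i) \<in> M"
  shows "\<not> poly_dependent (x 0) {..n} x"
proof
  assume poly_dependent: "poly_dependent (x 0) {..n} x"
  have xnz: "x i \<noteq> 0" and xM: "x i \<in> M" if "i \<le> n" for i using assms(1) that by auto
  obtain a w N where a: "\<exists>i\<in>{..n}. a i \<noteq> 0" and w: "\<And>i. w i \<in> polys (x 0) N"
    and eq: "(\<Sum>i\<le>n. (\<iota> (a i) + x 0 * w i) * x i) = 0"
    by (rule dep_normal_form[OF poly_dependent xnz[OF le0]]) blast
  have wR: "w i \<in> R" for i
    using w polys_over_subset[OF subalg_range subalg, of "x 0" N] xM[of 0] M_in_R R_const by auto
  have cR: "\<iota> (a i) + x 0 * w i \<in> R" for i
    using R_add R_const R_mult wR xM[of 0] M_in_R by auto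
  have quot: "i < j \<Longrightarrow> j \<le> n \<Longrightarrow> x i / x j \<in> M" for i j
  proof (induction j)
    case (Suc j)
    show ?case
    proof (cases "i = j")
      case False
      hence "x i / x j \<in> M" using Suc by auto
      from M_mult[OF M_in_R[OF this] step[of j]] show ?thesis
        using Suc.prems xnz[of j] by simp
    qed (use step Suc in auto)
  qed simp
  define j where "j = Max {i. i \<le> n \<and> a i \<noteq> 0}"
  have fin: "finite {i. i \<le> n \<and> a i \<noteq> 0}" by simp
  have "j \<in> {i. i \<le> n \<and> a i \<noteq> 0}" unfolding j_def by (rule Max_in[OF fin]) (use a in auto)
  hence j: "j \<le> n" "a j \<noteq> 0" by auto
  have above: "a i = 0" if "j < i" "i \<le> n" for i
    using Max_ge[OF fin, of i] that unfolding j_def by fastforce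
  have "(\<iota> (a i) + x 0 * w i) * x i / x j \<in> M" if i: "i \<in> {..n} - {j}" for i
  proof (cases "i < j")
    case True
    from M_mult[OF cR quot[OF True j(1)], of i] show ?thesis by simp
  next
    case False
    hence "a i = 0" using above i by auto
    moreover have "x 0 / x j \<in> R" using quot[of 0 j] j(1) xnz M_in_R R_one by (cases "j = 0") auto
    hence "(x 0 / x j * w i) * x i \<in> M" using i by (intro M_mult R_mult wR xM) auto
    ultimately show ?thesis by (simp add: algebra_simps)
  qed
  hence sM: "(\<Sum>i\<in>{..n} - {j}. (\<iota> (a i) + x 0 * w i) * x i / x j) \<in> M" by (rule M_sum)
  have "0 = (\<Sum>i\<le>n. (\<iota> (a i) + x 0 * w i) * x i / x j)"
    using eq by (simp flip: sum_divide_distrib)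
  also have "\<dots> = (\<iota> (a j) + x 0 * w j) + (\<Sum>i\<in>{..n} - {j}. (\<iota> (a i) + x 0 * w i) * x i / x j)"
    using j(1) xnz[of j] by (subst sum.remove[of "{..n}" j]) auto
  finally have "\<iota> (a j) = - (x 0 * w j + (\<Sum>i\<in>{..n} - {j}. (\<iota> (a i) + x 0 * w i) * x i / x j))"
    by (simp add: eq_neg_iff_add_eq_0 algebra_simps)
  moreover have "w j * x 0 \<in> M" using wR xM by (intro M_mult) auto
  ultimately have "\<iota> (a j) \<in> M" using M_minus[OF M_add[OF _ sM], of "x 0 * w j"] by (metis mult.commute)
  thus False using const_notin_M j(2) by blast
qed

text \<open>If \<open>M\<close> were not principal, every nonzero \<open>t\<close> in
  \<open>M\<close> would have a successor \<open>f t\<close> in \<open>M\<close> with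
  \<open>t / f t\<close> in \<open>M\<close>. Iteration gives chains of any length with the same
  first element, against the rank bound for that element.\<close>

lemma ex_uniformizer: "\<exists>t\<in>M. t \<noteq> 0 \<and> (\<forall>z\<in>M. z / t \<in> R)"
proof (rule ccontr)
  assume "\<not> ?thesis"
  then obtain f where f: "\<And>t. t \<in> M \<Longrightarrow> t \<noteq> 0 \<Longrightarrow> f t \<in> M \<and> f t / t \<notin> R" by metis
  obtain z where z: "z \<notin> R" using proper by blast
  define u where "u = inverse z"
  have u: "u \<in> M" "u \<noteq> 0"
    unfolding u_def using not_in_R_inverse_in_M[OF z] z R_zero by auto
  define x where "x = (\<lambda>i. (f ^^ i) u)"
  have x: "x i \<in> M \<and> x i \<noteq> 0" for i
  proof (induction i)
    case (Suc i)
    thus ?case using f[of "x i"] R_zero by (auto simp: x_def)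
  qed (use u in \<open>simp add: x_def\<close>)
  have "x i / x (Suc i) \<in> M" for i
  proof -
    have "x (Suc i) / x i \<notin> R" using f[of "x i"] x by (simp add: x_def)
    from not_in_R_inverse_in_M[OF this] show ?thesis by simp
  qed
  moreover obtain m where "poly_dependent (x 0) {..m} x" using ex_rank_bound by blast
  ultimately show False using chain_not_dep[of m x] x by blast
qed

definition unif :: 'f where
  "unif = (SOME t. t \<in> M \<and> t \<noteq> 0 \<and> (\<forall>z\<in>M. z / t \<in> R))"

lemma unif_in_M: "unif \<in> M" and unif_nonzero: "unif \<noteq> 0"
  and unif_divides: "z \<in> M \<Longrightarrow> z / unif \<in> R"
proof -
  have "\<exists>t. t \<in> M \<and> t \<noteq> 0 \<and> (\<forall>z\<in>M. z / t \<in> R)" using ex_uniformizer by blast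
  from someI_ex[OF this]
  show "unif \<in> M" "unif \<noteq> 0" "z \<in> M \<Longrightarrow> z / unif \<in> R" unfolding unif_def by auto
qed

section \<open>The order function of a valuation ring\<close>

definition unit :: "'f \<Rightarrow> bool" where
  "unit e \<longleftrightarrow> e \<in> R \<and> e \<notin> M"

lemma unit_iff: "unit e \<longleftrightarrow> e \<noteq> 0 \<and> e \<in> R \<and> inverse e \<in> R"
  unfolding unit_def M_def using R_zero by auto

text \<open>If \<open>z\<close> were divisible by all powers of the uniformizer, then for the rank
  bound \<open>m\<close> of \<open>z\<close> the elements \<open>z, unif ^ m, ..., unif\<close>
  would form a chain of \<open>m + 1\<close> independent elements.\<close>

lemma ex_order_in_R:
  assumes "z \<in> R" "z \<noteq> 0"
  shows "\<exists>n::nat. unit (z / unif ^ n)"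
proof (rule ccontr)
  assume neg: "\<not> ?thesis"
  have zM: "z / unif ^ n \<in> M" for n
  proof (induction n)
    case 0
    thus ?case using neg[unfolded unit_def not_ex, rule_format, of 0] assms by simp
  next
    case (Suc n)
    from unif_divides[OF this] have "z / unif ^ Suc n \<in> R" by (simp add: mult.commute)
    thus ?case using neg unfolding unit_def by blast
  qed
  obtain m where m: "\<forall>x :: nat \<Rightarrow> 'f. poly_dependent z {..m} x" using ex_rank_bound by blast
  define x where "x = (\<lambda>i. if i = 0 then z else unif ^ (Suc m - i))"
  have "x i \<in> M \<and> x i \<noteq> 0" if "i \<le> m" for i
  proof (cases "i = 0")
    case False
    have "unif ^ (m - i) * unif \<in> M"
      by (rule M_mult[OF R_power[OF M_in_R[OF unif_in_M]] unif_in_M])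
    moreover have "unif ^ (Suc m - i) = unif ^ (m - i) * unif" using that by (simp add: Suc_diff_le)
    ultimately show ?thesis using False unif_nonzero by (simp add: x_def)
  qed (use zM[of 0] assms in \<open>simp add: x_def\<close>)
  moreover have "x i / x (Suc i) \<in> M" if "i < m" for i
  proof (cases "i = 0")
    case False
    have "Suc m - i = Suc (m - i)" using that by simp
    thus ?thesis using False unif_in_M unif_nonzero by (simp add: x_def)
  qed (use zM in \<open>simp add: x_def\<close>)
  ultimately have "\<not> poly_dependent (x 0) {..m} x" by (rule chain_not_dep)
  thus False using m by (simp add: x_def)
qed

lemma ex_order:
  assumes "z \<noteq> 0"
  shows "\<exists>n::int. unit (z * unif powi (- n))"
proof (cases "z \<in> R")
  case True
  then obtain n :: nat where "unit (z / unif ^ n)" using ex_order_in_R assms by blast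
  thus ?thesis
    by (intro exI[of _ "int n"]) (simp add: power_int_minus divide_inverse)
next
  case False
  then obtain n :: nat where "unit (inverse z / unif ^ n)"
    using ex_order_in_R[of "inverse z"] assms total by auto
  moreover have "inverse (inverse z / unif ^ n) = z * unif ^ n" by (simp add: field_simps)
  ultimately have "unit (z * unif ^ n)" unfolding unit_iff using unif_nonzero assms
    by (metis inverse_inverse_eq inverse_nonzero_iff_nonzero)
  thus ?thesis by (intro exI[of _ "- int n"]) simp
qed

lemma unit_mult: "unit a \<Longrightarrow> unit b \<Longrightarrow> unit (a * b)"
  unfolding unit_iff using R_mult by auto

lemma unif_powi_in_R: "0 \<le> n \<Longrightarrow> unif powi n \<in> R"
  using R_power[OF M_in_R[OF unif_in_M], of "nat n"] by (simp add: power_int_def)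

lemma unif_powi_in_M:
  assumes "0 < n"
  shows "unif powi n \<in> M"
proof -
  have "unif powi n = unif powi (n - 1) * unif"
    using power_int_add_1[of unif "n - 1"] unif_nonzero by simp
  thus ?thesis using M_mult[OF unif_powi_in_R unif_in_M, of "n - 1"] assms by simp
qed

definition ord :: "'f \<Rightarrow> int" where
  "ord z = (if z = 0 then 0 else SOME n. unit (z * unif powi (- n)))"

lemma ord_unit: "z \<noteq> 0 \<Longrightarrow> unit (z * unif powi (- ord z))"
  using someI_ex[OF ex_order, of z] by (simp add: ord_def)

lemma ord_ge_iff:
  assumes "z \<noteq> 0"
  shows "n \<le> ord z \<longleftrightarrow> z * unif powi (- n) \<in> R"
proof
  have eq: "z * unif powi (- n) = (z * unif powi (- ord z)) * unif powi (ord z - n)" for n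
    using unif_nonzero by (simp add: power_int_add[symmetric] mult.assoc)
  show "z * unif powi (- n) \<in> R" if "n \<le> ord z"
    using R_mult[OF _ unif_powi_in_R, of "z * unif powi (- ord z)" "ord z - n"] ord_unit[OF assms] that
    by (simp add: unit_def flip: eq)
  assume r: "z * unif powi (- n) \<in> R"
  show "n \<le> ord z"
  proof (rule ccontr)
    assume "\<not> n \<le> ord z"
    hence "(z * unif powi (- n)) * unif powi (n - ord z) \<in> M"
      using r unif_powi_in_M by (intro M_mult) auto
    also have "(z * unif powi (- n)) * unif powi (n - ord z) = z * unif powi (- ord z)"
      using unif_nonzero by (simp add: power_int_add[symmetric] mult.assoc)
    finally show False using ord_unit[OF assms] by (simp add: unit_def)
  qed
qed

lemma ord_unique:
  assumes "z \<noteq> 0" "unit (z * unif powi (- n))"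
  shows "ord z = n"
proof (rule antisym)
  show "n \<le> ord z" using assms by (simp add: ord_ge_iff unit_def)
  show "ord z \<le> n"
  proof (rule ccontr)
    assume "\<not> ord z \<le> n"
    hence "n + 1 \<le> ord z" by simp
    hence "z * unif powi (- (n + 1)) \<in> R" using ord_ge_iff assms by blast
    from M_mult[OF this unif_in_M] have "z * unif powi (- (n + 1)) * unif \<in> M" .
    also have "z * unif powi (- (n + 1)) * unif = z * unif powi (- n)"
      using unif_nonzero power_int_add_1[of unif "- (n + 1)"] by (simp add: mult.assoc)
    finally show False using assms by (simp add: unit_def)
  qed
qed

lemma ord_mult:
  assumes "x \<noteq> 0" "y \<noteq> 0"
  shows "ord (x * y) = ord x + ord y"
proof (rule ord_unique)
  have "(x * unif powi (- ord x)) * (y * unif powi (- ord y)) = x * y * unif powi (- (ord x + ord y))"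
    using unif_nonzero by (simp add: power_int_diff power_int_minus power_int_add field_simps)
  thus "unit (x * y * unif powi (- (ord x + ord y)))" using unit_mult ord_unit assms by metis
qed (use assms in simp)

lemma ord_add:
  assumes "x \<noteq> 0" "y \<noteq> 0" "x + y \<noteq> 0"
  shows "min (ord x) (ord y) \<le> ord (x + y)"
proof -
  define n where "n = min (ord x) (ord y)"
  have "x * unif powi (- n) \<in> R" "y * unif powi (- n) \<in> R"
    using assms by (auto simp: n_def ord_ge_iff[symmetric])
  hence "(x + y) * unif powi (- n) \<in> R" using R_add by (simp add: distrib_right)
  thus ?thesis using ord_ge_iff[OF assms(3)] by (simp add: n_def)
qed

lemma ord_in_points: "ord \<in> points \<iota>"
  unfolding points_def
proof (intro CollectI conjI allI impI)
  show "ord 0 = 0" by (simp add: ord_def)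
  show "surj ord"
  proof (rule surjI)
    fix n
    have "unif powi n * unif powi (- n) = 1"
      using unif_nonzero by (simp add: power_int_add[symmetric])
    thus "ord (unif powi n) = n"
      using unif_nonzero R_one by (intro ord_unique) (auto simp: unit_iff)
  qed
  show "ord (\<iota> a) = 0" if "a \<noteq> 0" for a
    using that R_const const_notin_M by (intro ord_unique) (auto simp: unit_def)
qed (use ord_mult ord_add in auto)

lemma ord_neg:
  assumes "y \<notin> R"
  shows "ord y < 0"
proof (rule ccontr)
  assume "\<not> ord y < 0"
  moreover have "y \<noteq> 0" using assms R_zero by auto
  ultimately show False using ord_ge_iff[of y 0] assms by auto
qed

end

text \<open>A valuation ring omitting \<open>y\<close> is proper, so its order function is a point,
  and elements outside the ring have negative order.\<close>

lemma (in function_field) ex_pole: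
  assumes "y \<notin> range \<iota>"
  shows "\<exists>v\<in>points \<iota>. v y < 0"
proof -
  obtain R where R: "subalg R" "y \<notin> R" "inverse y \<in> R" "\<And>z. z \<in> R \<or> inverse z \<in> R"
    using ex_valuation_ring[OF assms] by blast
  interpret valuation_ring \<iota> R
    by unfold_locales (use R in auto)
  show ?thesis using ord_in_points ord_neg[OF R(2)] by blast
qed

context function_field
begin

interpretation vs: vector_space "scale_by \<iota>"
  by (rule vector_space_scale_by)

section \<open>Valuations and residue fields\<close>

lemma pt_mult: "v \<in> points \<iota> \<Longrightarrow> x \<noteq> 0 \<Longrightarrow> y \<noteq> 0 \<Longrightarrow> v (x * y) = v x + v y"
  and pt_const: "v \<in> points \<iota> \<Longrightarrow> v (\<iota> a) = 0"
  and pt_zero: "v \<in> points \<iota> \<Longrightarrow> v 0 = 0"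
  unfolding points_def by (auto, cases "a = 0", auto)

lemma pt_one: "v \<in> points \<iota> \<Longrightarrow> v 1 = 0"
  using pt_const[of v 1] by (simp add: hom_one)

lemma pt_inverse:
  assumes "v \<in> points \<iota>"
  shows "v (inverse x) = - v x"
proof (cases "x = 0")
  case False
  thus ?thesis using pt_mult[OF assms, of x "inverse x"] pt_one[OF assms] by simp
qed (simp add: pt_zero[OF assms])

lemma pt_minus:
  assumes "v \<in> points \<iota>"
  shows "v (- x) = v x"
proof (cases "x = 0")
  case False
  thus ?thesis using pt_mult[OF assms, of "\<iota> (- 1)" x] pt_const[OF assms, of "- 1"]
    by (simp add: hom_minus hom_one)
qed simp

lemma pt_power:
  assumes "v \<in> points \<iota>" "x \<noteq> 0"
  shows "v (x ^ n) = int n * v x"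
  by (induction n) (use assms in \<open>auto simp: pt_one pt_mult algebra_simps\<close>)

lemma ex_pt_eq_1:
  assumes "v \<in> points \<iota>"
  obtains t where "v t = 1" "t \<noteq> 0"
proof -
  have "surj v" using assms unfolding points_def by simp
  then obtain t where "v t = 1" by (metis surjD)
  thus ?thesis using that pt_zero[OF assms] by force
qed

text \<open>The inequality \<open>v z \<ge> n\<close> with the convention
  \<open>v 0 = \<infinity>\<close>. It undoes the dummy value at 0, so that the functions satisfying
  it form a subspace.\<close>

definition vge :: "'f point \<Rightarrow> int \<Rightarrow> 'f \<Rightarrow> bool" where
  "vge v n z \<longleftrightarrow> z = 0 \<or> n \<le> v z"

lemma vge_zero: "vge v n 0"
  by (simp add: vge_def)

lemma vge_self: "vge v (v z) z"
  by (simp add: vge_def)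

lemma vge_mono: "vge v n z \<Longrightarrow> m \<le> n \<Longrightarrow> vge v m z"
  by (auto simp: vge_def)

lemma vge_add:
  assumes "v \<in> points \<iota>" "vge v n x" "vge v n y"
  shows "vge v n (x + y)"
proof (cases "x = 0 \<or> y = 0 \<or> x + y = 0")
  case False
  hence "min (v x) (v y) \<le> v (x + y)" using assms(1) unfolding points_def by auto
  thus ?thesis using assms False by (auto simp: vge_def)
qed (use assms in \<open>auto simp: vge_def\<close>)

lemma vge_minus: "v \<in> points \<iota> \<Longrightarrow> vge v n (- x) \<longleftrightarrow> vge v n x"
  by (simp add: vge_def pt_minus)

lemma vge_diff: "v \<in> points \<iota> \<Longrightarrow> vge v n x \<Longrightarrow> vge v n y \<Longrightarrow> vge v n (x - y)"
  using vge_add[of v n x "- y"] by (simp add: vge_minus)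

lemma vge_sum: "v \<in> points \<iota> \<Longrightarrow> (\<And>i. i \<in> I \<Longrightarrow> vge v n (f i)) \<Longrightarrow> vge v n (sum f I)"
  by (induction I rule: infinite_finite_induct) (auto intro: vge_zero vge_add)

lemma vge_mult: "v \<in> points \<iota> \<Longrightarrow> vge v m x \<Longrightarrow> vge v n y \<Longrightarrow> vge v (m + n) (x * y)"
  by (cases "x * y = 0") (auto simp: vge_def pt_mult)

lemma vge_mult_left: "v \<in> points \<iota> \<Longrightarrow> vge v 0 x \<Longrightarrow> vge v n y \<Longrightarrow> vge v n (x * y)"
  using vge_mult[of v 0 x n y] by simp

lemma vge_const: "v \<in> points \<iota> \<Longrightarrow> vge v 0 (\<iota> a)"
  by (simp add: vge_def pt_const)

lemma vge_scale: "v \<in> points \<iota> \<Longrightarrow> vge v n x \<Longrightarrow> vge v n (\<iota> a * x)"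
  by (rule vge_mult_left) (auto intro: vge_const)

text \<open>The strict case of the ultrametric inequality: if the sum had a larger value than
  \<open>x\<close>, subtracting \<open>y\<close> would give \<open>x\<close> a value above its
  own.\<close>

lemma pt_add_eq:
  assumes v: "v \<in> points \<iota>" and "x \<noteq> 0" "vge v (v x + 1) y"
  shows "x + y \<noteq> 0 \<and> v (x + y) = v x"
proof -
  have ge: "vge v (v x) (x + y)"
    by (rule vge_add[OF v vge_self]) (rule vge_mono[OF assms(3)], simp)
  have "\<not> vge v (v x + 1) (x + y)"
  proof
    assume "vge v (v x + 1) (x + y)"
    from vge_diff[OF v this assms(3)] show False using assms(2) by (simp add: vge_def)
  qed
  thus ?thesis using ge by (auto simp: vge_def)
qed

lemma local_ring_eq: "local_ring v = {x. vge v 0 x}"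
  by (auto simp: local_ring_def vge_def)

lemma max_ideal_eq: "max_ideal v = {x. vge v 1 x}"
  by (auto simp: max_ideal_def vge_def)

lemma subalg_local_ring: "v \<in> points \<iota> \<Longrightarrow> subalg (local_ring v)"
  unfolding subalg_def local_ring_eq
  by (auto intro: vge_const vge_add vge_mult_left)

lemma vge_polys:
  assumes "v \<in> points \<iota>" "vge v 0 x" "a \<in> polys x N"
  shows "vge v 0 a"
  using polys_over_subset[OF subalg_range subalg_local_ring[OF assms(1)], of x N] assms
    subalg_const[OF subalg_local_ring[OF assms(1)]] by (auto simp: local_ring_eq)

lemma subspace_vge: "v \<in> points \<iota> \<Longrightarrow> vs.subspace {x. vge v n x}"
  unfolding vs.subspace_def by (auto intro: vge_zero vge_add vge_scale)

text \<open>A basis of the maximal ideal is extended to one of the local ring; the added vectors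
  span a complement, which represents the residue field. No finiteness is used, so the choice in
  \<open>point_degree\<close> is meaningful from the start.\<close>

lemma ex_residue_basis:
  assumes v: "v \<in> points \<iota>"
  shows "\<exists>S. residue_basis \<iota> v S"
proof -
  have sl: "vs.subspace (local_ring v)" and sm: "vs.subspace (max_ideal v)"
    unfolding local_ring_eq max_ideal_eq by (rule subspace_vge[OF v])+
  have ml: "max_ideal v \<subseteq> local_ring v"
    unfolding local_ring_eq max_ideal_eq using vge_mono[of v 1 _ 0] by auto
  obtain B where B: "B \<subseteq> max_ideal v" "vs.independent B" "max_ideal v \<subseteq> vs.span B"
    using vs.maximal_independent_subset_extend[of "{}" "max_ideal v"] vs.independent_empty by auto
  obtain D where D: "B \<subseteq> D" "D \<subseteq> local_ring v" "vs.independent D" "local_ring v \<subseteq> vs.span D"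
    using vs.maximal_independent_subset_extend[of B "local_ring v"] B ml by blast
  have spB: "vs.span B = max_ideal v"
    using B vs.span_minimal[OF B(1) sm] by blast
  have spD: "vs.span D = local_ring v"
    using D vs.span_minimal[OF D(2) sl] by blast
  define S where "S = D - B"
  have "vs.span S \<inter> vs.span B \<subseteq> {0}"
  proof
    fix x assume x: "x \<in> vs.span S \<inter> vs.span B"
    have D': "x \<in> vs.span D" using x vs.span_mono[of S D] S_def by auto
    have "vs.representation D x = vs.representation S x"
      by (rule vs.representation_extend[OF D(3)]) (use x in \<open>auto simp: S_def\<close>)
    moreover have "vs.representation D x = vs.representation B x"
      by (rule vs.representation_extend[OF D(3)]) (use x D in auto)
    ultimately have "vs.representation D x b = 0" for b
      using vs.representation_ne_zero[of S x b] vs.representation_ne_zero[of B x b] S_def by auto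
    thus "x \<in> {0}" using vs.sum_nonzero_representation_eq[OF D(3) D'] by simp
  qed
  hence int: "vs.span S \<inter> max_ideal v = {0}"
    using spB vs.span_zero[of S] sm vs.subspace_0 by auto
  have "local_ring v = {x + m |x m. x \<in> vs.span S \<and> m \<in> max_ideal v}"
  proof -
    have "vs.span D = vs.span (S \<union> B)" using D(1) by (simp add: S_def Un_absorb2)
    thus ?thesis using spD spB by (simp add: vs.span_Un)
  qed
  moreover have "vs.independent S" using vs.independent_mono[OF D(3)] S_def by blast
  ultimately have "residue_basis \<iota> v S"
    unfolding residue_basis_def using D(2) int by (auto simp: S_def)
  thus ?thesis by blast
qed

definition rbasis :: "'f point \<Rightarrow> 'f set" where
  "rbasis v = (SOME S. residue_basis \<iota> v S)"

lemma residue_basis_rbasis: "v \<in> points \<iota> \<Longrightarrow> residue_basis \<iota> v (rbasis v)"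
  unfolding rbasis_def by (rule someI_ex[OF ex_residue_basis])

lemma point_degree_eq: "point_degree \<iota> v = card (rbasis v)"
  by (simp add: point_degree_def rbasis_def)

lemma rbasis_vge: "v \<in> points \<iota> \<Longrightarrow> s \<in> rbasis v \<Longrightarrow> vge v 0 s"
  using residue_basis_rbasis unfolding residue_basis_def local_ring_eq by blast

lemma rbasis_independent: "v \<in> points \<iota> \<Longrightarrow> vs.independent (rbasis v)"
  using residue_basis_rbasis unfolding residue_basis_def by blast

lemma residue_independent:
  assumes v: "v \<in> points \<iota>" and "finite T" "T \<subseteq> rbasis v"
    and "vge v 1 (\<Sum>s\<in>T. \<iota> (a s) * s)" "s \<in> T"
  shows "a s = 0"
proof -
  have "(\<Sum>s\<in>T. \<iota> (a s) * s) \<in> vs.span (rbasis v)"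
    using assms(3) by (intro vs.span_sum vs.span_scale vs.span_base) auto
  hence "(\<Sum>s\<in>T. \<iota> (a s) * s) = 0"
    using assms(4) residue_basis_rbasis[OF v] unfolding residue_basis_def max_ideal_eq by blast
  thus ?thesis
    using rbasis_independent[OF v] assms(2,3,5) unfolding vs.independent_explicit_finite_subsets by blast
qed

text \<open>Too many elements of the basis would satisfy a relation over the polynomials in a
  uniformizer \<open>t\<close>, which modulo \<open>t\<close> becomes a nontrivial relation between
  residues over \<open>k\<close>. For an infinite basis, \<open>card\<close> would report the degree
  as 0.\<close>

lemma finite_rbasis:
  assumes v: "v \<in> points \<iota>"
  shows "finite (rbasis v)"
proof (rule ccontr)
  assume inf: "infinite (rbasis v)"
  obtain t where t: "v t = 1" "t \<noteq> 0" using ex_pt_eq_1[OF v] by blast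
  obtain m where m: "\<forall>z :: nat \<Rightarrow> 'f. poly_dependent t {..m} z" using ex_rank_bound by blast
  obtain T where T: "T \<subseteq> rbasis v" "finite T" "card T = Suc m"
    using infinite_arbitrarily_large[OF inf, of "Suc m"] by blast
  have poly_dependent: "poly_dependent t T (\<lambda>s. s)" by (rule dep_reindex[OF m T(2)]) (simp add: T)
  obtain a w N where a: "\<exists>s\<in>T. a s \<noteq> 0" and w: "\<And>s. w s \<in> polys t N"
    and eq: "(\<Sum>s\<in>T. (\<iota> (a s) + t * w s) * s) = 0"
    by (rule dep_normal_form[OF poly_dependent t(2)]) blast
  have "(\<Sum>s\<in>T. \<iota> (a s) * s) = - (\<Sum>s\<in>T. t * (w s * s))"
    using eq by (simp add: distrib_right sum.distrib mult.assoc eq_neg_iff_add_eq_0)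
  moreover have "vge v 1 (\<Sum>s\<in>T. t * (w s * s))"
  proof (rule vge_sum[OF v])
    fix s assume "s \<in> T"
    hence "vge v 0 s" using rbasis_vge[OF v] T by blast
    moreover have "vge v 0 (w s)" by (rule vge_polys[OF v _ w]) (simp add: vge_def t)
    ultimately have "vge v 0 (w s * s)" by (intro vge_mult_left[OF v])
    moreover have "vge v 1 t" using t by (simp add: vge_def)
    ultimately show "vge v 1 (t * (w s * s))" using vge_mult[OF v, of 1 t 0 "w s * s"] by simp
  qed
  ultimately have "vge v 1 (\<Sum>s\<in>T. \<iota> (a s) * s)" by (simp add: vge_minus[OF v])
  thus False using residue_independent[OF v T(2,1)] a by blast
qed

lemma point_degree_pos:
  assumes v: "v \<in> points \<iota>"
  shows "0 < point_degree \<iota> v"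
proof (rule ccontr)
  assume "\<not> ?thesis"
  hence "rbasis v = {}" using finite_rbasis[OF v] by (simp add: point_degree_eq)
  hence "local_ring v = {0 + m |m. m \<in> max_ideal v}"
    using residue_basis_rbasis[OF v] unfolding residue_basis_def by (simp add: vs.span_empty)
  moreover have "1 \<in> local_ring v" "1 \<notin> max_ideal v"
    by (auto simp: local_ring_eq max_ideal_eq vge_def pt_one[OF v])
  ultimately show False by auto
qed

lemma card_span:
  assumes "finite B" "vs.independent B"
  shows "finite (vs.span B) \<and> card (vs.span B) = CARD('k) ^ card B"
proof -
  define f where "f = (\<lambda>c. \<Sum>b\<in>B. \<iota> (c b) * b)"
  have "vs.span B = f ` (B \<rightarrow>\<^sub>E UNIV)"
  proof -
    have "f (restrict c B) = f c" for c unfolding f_def by (rule sum.cong) auto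
    hence "f c \<in> f ` (B \<rightarrow>\<^sub>E UNIV)" for c by (metis (no_types, lifting) image_eqI UNIV_I restrict_PiE_iff)
    thus ?thesis unfolding vs.span_finite[OF assms(1)] f_def by auto
  qed
  moreover have "inj_on f (B \<rightarrow>\<^sub>E UNIV)"
  proof (rule inj_onI)
    fix c d assume cd: "c \<in> B \<rightarrow>\<^sub>E UNIV" "d \<in> B \<rightarrow>\<^sub>E UNIV" "f c = f d"
    have "(\<Sum>b\<in>B. \<iota> (c b - d b) * b) = 0"
      using cd(3) unfolding f_def by (simp add: hom_diff left_diff_distrib sum_subtractf)
    hence "c b - d b = 0" if "b \<in> B" for b
      using assms(2)[unfolded vs.independent_explicit_finite_subsets, rule_format, OF order_refl assms(1),
          of "\<lambda>b. c b - d b"] that by blast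
    thus "c = d" using PiE_ext[OF cd(1,2)] by auto
  qed
  ultimately show ?thesis
    using assms(1) card_PiE[OF assms(1), of "\<lambda>_. UNIV :: 'k set"] by (simp add: card_image finite_PiE)
qed

text \<open>A \<open>k\<close>-subspace containing exactly one representative of each residue
  class.\<close>

definition residues :: "'f point \<Rightarrow> 'f set" where
  "residues v = vs.span (rbasis v)"

lemma card_residues:
  assumes "v \<in> points \<iota>"
  shows "finite (residues v)" "card (residues v) = CARD('k) ^ point_degree \<iota> v"
  using card_span[OF finite_rbasis[OF assms] rbasis_independent[OF assms]]
  by (auto simp: residues_def point_degree_eq)

lemma ex_residue:
  assumes "v \<in> points \<iota>" "vge v 0 x"
  shows "\<exists>r\<in>residues v. vge v 1 (x - r)"
proof -
  have "x \<in> {x + m |x m. x \<in> residues v \<and> m \<in> max_ideal v}"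
    using residue_basis_rbasis[OF assms(1)] assms(2)
    unfolding residue_basis_def residues_def local_ring_eq by blast
  then obtain r m where "x = r + m" "r \<in> residues v" "vge v 1 m" by (auto simp: max_ideal_eq)
  thus ?thesis by (intro bexI[of _ r]) auto
qed

section \<open>Weak approximation and the degree of the divisor of zeros\<close>

text \<open>Inclusion of the valuation rings makes units of \<open>v\<close> units of
  \<open>w\<close>, so \<open>w\<close> is \<open>w t\<close> times \<open>v\<close> for a
  uniformizer \<open>t\<close> of \<open>v\<close>. Since \<open>w\<close> attains 1, this factor
  divides 1, and it is nonnegative.\<close>

lemma points_eq_if_le:
  assumes v: "v \<in> points \<iota>" and w: "w \<in> points \<iota>"
    and le: "\<And>x. x \<noteq> 0 \<Longrightarrow> 0 \<le> v x \<Longrightarrow> 0 \<le> w x"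
  shows "v = w"
proof -
  have eq0: "w x = 0" if "v x = 0" "x \<noteq> 0" for x
    using le[of x] le[of "inverse x"] that by (simp add: pt_inverse[OF v] pt_inverse[OF w])
  obtain t where t: "v t = 1" "t \<noteq> 0" using ex_pt_eq_1[OF v] by blast
  have nn: "w x = v x * w t" if x: "x \<noteq> 0" "0 \<le> v x" for x
  proof -
    have "v (x * inverse (t ^ nat (v x))) = 0"
      using x t pt_mult[OF v, of x "inverse (t ^ nat (v x))"] pt_inverse[OF v] pt_power[OF v, of t] by simp
    hence "w (x * inverse (t ^ nat (v x))) = 0" using x t by (intro eq0) auto
    thus ?thesis
      using x t pt_mult[OF w, of x "inverse (t ^ nat (v x))"] pt_inverse[OF w] pt_power[OF w, of t] by simp
  qed
  have all: "w x = v x * w t" if x: "x \<noteq> 0" for x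
    using nn[of x] nn[of "inverse x"] x by (cases "0 \<le> v x") (auto simp: pt_inverse[OF v] pt_inverse[OF w])
  obtain s where s: "w s = 1" "s \<noteq> 0" using ex_pt_eq_1[OF w] by blast
  have "w t dvd 1" using all[OF s(2)] s(1) by (metis dvd_triv_right)
  moreover have "0 \<le> w t" using le[of t] t by simp
  ultimately have "w t = 1" by (simp add: zdvd1_eq)
  hence "v x = w x" for x using all[of x] by (cases "x = 0") (auto simp: pt_zero v w)
  thus ?thesis by auto
qed

lemma ex_separating_two:
  assumes v: "v \<in> points \<iota>" and w: "w \<in> points \<iota>" and "v \<noteq> w"
  shows "\<exists>f. f \<noteq> 0 \<and> 0 < v f \<and> w f < 0"
proof -
  obtain a where a: "a \<noteq> 0" "0 \<le> v a" "w a < 0"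
    using points_eq_if_le[OF v w] \<open>v \<noteq> w\<close> by (meson not_le)
  obtain b where b: "b \<noteq> 0" "0 \<le> w b" "v b < 0"
    using points_eq_if_le[OF w v] \<open>v \<noteq> w\<close> by (metis not_le)
  show ?thesis using a b
    by (intro exI[of _ "a * inverse b"])
       (auto simp: pt_mult[OF v] pt_mult[OF w] pt_inverse[OF v] pt_inverse[OF w])
qed

text \<open>Induction on \<open>T\<close>: add to \<open>f\<close> a high power of some
  \<open>g\<close> with a zero at \<open>v\<close> and a pole at the new point. The exponent exceeds
  all absolute values of \<open>f\<close> on the set, so \<open>g ^ r\<close> dominates wherever
  \<open>g\<close> has a pole; elsewhere on the set the pole of \<open>f\<close> dominates.\<close>

lemma ex_separating:
  assumes v: "v \<in> points \<iota>" and "finite T" "T \<subseteq> points \<iota>" "v \<notin> T"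
  shows "\<exists>f. f \<noteq> 0 \<and> 0 < v f \<and> (\<forall>w\<in>T. w f < 0)"
  using assms(2-4)
proof (induction T rule: finite_induct)
  case empty
  obtain t where "v t = 1" "t \<noteq> 0" using ex_pt_eq_1[OF v] by blast
  thus ?case by (intro exI[of _ t]) auto
next
  case (insert w T)
  then obtain f where f: "f \<noteq> 0" "0 < v f" "\<And>u. u \<in> T \<Longrightarrow> u f < 0" by auto
  have w: "w \<in> points \<iota>" "v \<noteq> w" using insert by auto
  obtain g where g: "g \<noteq> 0" "0 < v g" "w g < 0" using ex_separating_two[OF v w] by blast
  define r where "r = Suc (\<Sum>u\<in>insert w T. nat \<bar>u f\<bar>)"
  have r: "\<bar>u f\<bar> < int r" if "u \<in> insert w T" for u
  proof -
    have "nat \<bar>u f\<bar> < r"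
      using member_le_sum[of u "insert w T" "\<lambda>u. nat \<bar>u f\<bar>"] that insert(1) unfolding r_def by auto
    thus ?thesis by linarith
  qed
  have neg: "f + g ^ r \<noteq> 0 \<and> u (f + g ^ r) < 0" if u: "u \<in> insert w T" for u
  proof -
    have pu: "u \<in> points \<iota>" using u insert by auto
    have gr: "u (g ^ r) = int r * u g" "g ^ r \<noteq> 0" using pt_power[OF pu g(1)] g(1) by auto
    show ?thesis
    proof (cases "u g < 0")
      case True
      hence "int r * u g \<le> - int r" using mult_left_mono[of "u g" "- 1" "int r"] by simp
      hence lt: "u (g ^ r) < u f" "u (g ^ r) < 0" using gr(1) r[OF u] by auto
      hence "vge u (u (g ^ r) + 1) f" by (simp add: vge_def)
      from pt_add_eq[OF pu gr(2) this] show ?thesis using lt by (simp add: add.commute)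
    next
      case False
      hence "u \<in> T" using u g(3) by auto
      hence lt: "u f < 0" using f(3) by blast
      have "0 \<le> u (g ^ r)" using False gr(1) by simp
      hence "vge u (u f + 1) (g ^ r)" using lt by (simp add: vge_def)
      from pt_add_eq[OF pu f(1) this] show ?thesis using lt by simp
    qed
  qed
  have "vge v 1 (f + g ^ r)"
  proof (rule vge_add[OF v])
    have "1 \<le> int r * v g"
      using mult_mono[of 1 "int r" 1 "v g"] g(2) by (simp add: r_def)
    thus "vge v 1 (g ^ r)" using pt_power[OF v g(1)] by (simp add: vge_def)
  qed (use f in \<open>simp add: vge_def\<close>)
  thus ?case using neg by (intro exI[of _ "f + g ^ r"]) (auto simp: vge_def)
qed

text \<open>For \<open>f\<close> with a zero at \<open>v\<close> and poles on \<open>T\<close>, the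
  functions \<open>1 / (1 + f ^ n)\<close> tend to 1 at \<open>v\<close> and to 0 at the points of
  \<open>T\<close>.\<close>

lemma approximation:
  assumes v: "v \<in> points \<iota>" and T: "finite T" "T \<subseteq> points \<iota>" "v \<notin> T"
  shows "\<exists>h. vge v (int N) (h - 1) \<and> (\<forall>w\<in>T. vge w (int N) h)"
proof -
  obtain f where f: "f \<noteq> 0" "0 < v f" "\<And>w. w \<in> T \<Longrightarrow> w f < 0" using ex_separating[OF v T] by blast
  define n where "n = Suc N"
  have "int n * 1 \<le> int n * v f" by (rule mult_left_mono) (use f in auto)
  hence vn: "int N + 1 \<le> v (f ^ n)" using pt_power[OF v f(1), of n] n_def by linarith
  have 1: "1 + f ^ n \<noteq> 0 \<and> v (1 + f ^ n) = 0"
    using pt_add_eq[OF v, of 1 "f ^ n"] vn by (simp add: pt_one[OF v] vge_def)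
  define h where "h = inverse (1 + f ^ n)"
  have "h - 1 = - (f ^ n * h)" using 1 by (simp add: h_def field_simps)
  moreover have "vge v (int N) (f ^ n * h)"
    using 1 vn f(1) unfolding vge_def h_def by (simp add: pt_mult[OF v] pt_inverse[OF v])
  ultimately have "vge v (int N) (h - 1)" by (simp add: vge_minus[OF v])
  moreover have "vge w (int N) h" if wT: "w \<in> T" for w
  proof -
    have w: "w \<in> points \<iota>" using wT T by blast
    have wn: "w (f ^ n) \<le> - int n"
      using pt_power[OF w f(1), of n] mult_left_mono[of "w f" "- 1" "int n"] f(3)[OF wT] by simp
    hence "f ^ n + 1 \<noteq> 0 \<and> w (f ^ n + 1) = w (f ^ n)"
      using pt_add_eq[OF w, of "f ^ n" 1] f(1) by (simp add: pt_one[OF w] vge_def n_def)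
    thus ?thesis using wn by (simp add: h_def vge_def pt_inverse[OF w] add.commute n_def)
  qed
  ultimately show ?thesis by blast
qed

text \<open>These are the first \<open>e\<close> digits of a \<open>t\<close>-adic expansion. A
  lowest nonzero digit would have nonzero residue, which terms of higher order cannot
  cancel.\<close>

lemma expansion_independent:
  assumes v: "v \<in> points \<iota>" and t: "v t = 1" "t \<noteq> 0"
    and ge: "vge v (int e) (\<Sum>i<e. \<Sum>s\<in>rbasis v. \<iota> (a i s) * (s * t ^ i))"
  shows "i < e \<Longrightarrow> s \<in> rbasis v \<Longrightarrow> a i s = 0"
proof (induction i arbitrary: s rule: less_induct)
  case (less i)
  have tn: "v (t ^ j) = int j" for j using pt_power[OF v t(2)] t(1) by simp
  define b where "b = (\<lambda>i. \<Sum>s\<in>rbasis v. \<iota> (a i s) * s)"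
  have b0: "vge v 0 (b j)" for j unfolding b_def
    by (intro vge_sum[OF v] vge_scale[OF v] rbasis_vge[OF v])
  have bsum: "(\<Sum>i<e. \<Sum>s\<in>rbasis v. \<iota> (a i s) * (s * t ^ i)) = (\<Sum>i<e. b i * t ^ i)"
    unfolding b_def by (simp add: sum_distrib_right mult.assoc)
  have low: "b j = 0" if "j < i" for j
    unfolding b_def using less.IH[OF that] less.prems that by (intro sum.neutral) auto
  have "(\<Sum>j<e. b j * t ^ j) = b i * t ^ i + (\<Sum>j\<in>{..<e} - {i}. b j * t ^ j)"
    using less.prems by (intro sum.remove) auto
  hence "b i * t ^ i = (\<Sum>j<e. b j * t ^ j) - (\<Sum>j\<in>{..<e} - {i}. b j * t ^ j)" by simp
  moreover have "vge v (int i + 1) (\<Sum>j<e. b j * t ^ j)"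
    using vge_mono[OF ge[unfolded bsum], of "int i + 1"] less.prems by simp
  moreover have "vge v (int i + 1) (\<Sum>j\<in>{..<e} - {i}. b j * t ^ j)"
  proof (rule vge_sum[OF v])
    fix j assume j: "j \<in> {..<e} - {i}"
    show "vge v (int i + 1) (b j * t ^ j)"
    proof (cases "j < i")
      case False
      hence "vge v (int i + 1) (t ^ j)" using j by (simp add: vge_def tn)
      thus ?thesis by (rule vge_mult_left[OF v b0])
    qed (simp add: low vge_zero)
  qed
  ultimately have "vge v (int i + 1) (b i * t ^ i)" using vge_diff[OF v] by simp
  hence "vge v 1 (b i)"
    using t(2) pt_mult[OF v, of "b i" "t ^ i"] tn[of i] by (cases "b i = 0") (auto simp: vge_def)
  thus ?case unfolding b_def
    using residue_independent[OF v finite_rbasis[OF v] order_refl, of "a i" s] less.prems by blast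
qed

text \<open>At a zero \<open>v\<close> the elements \<open>s * t ^ i\<close> with
  \<open>i < v x\<close> number \<open>v x\<close> times the degree of \<open>v\<close>. Multiplied
  by functions near 1 at \<open>v\<close> and near 0 at the other chosen zeros, all of them together
  are independent over the polynomials in \<open>x\<close>: a relation nontrivial modulo
  \<open>x\<close> would be, at some zero, a relation between local digits.\<close>

lemma zeros_degree_le:
  assumes m: "\<forall>z :: nat \<Rightarrow> 'f. poly_dependent x {..m} z"
    and T: "finite T" "T \<subseteq> points \<iota>" and zeros: "\<And>v. v \<in> T \<Longrightarrow> 0 < v x"
  shows "(\<Sum>v\<in>T. nat (v x) * point_degree \<iota> v) \<le> m"
proof (rule ccontr)
  define I where "I = (SIGMA v:T. {..<nat (v x)} \<times> rbasis v)"
  have finI: "finite I" unfolding I_def using T finite_rbasis by (intro finite_SigmaI) auto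
  have cardI: "card I = (\<Sum>v\<in>T. nat (v x) * point_degree \<iota> v)"
    unfolding I_def using T finite_rbasis
    by (subst card_SigmaI) (auto simp: card_cartesian_product point_degree_eq)
  assume "\<not> ?thesis"
  hence "m < card I" using cardI by simp
  define t where "t = (\<lambda>v::'f point. SOME t. v t = 1 \<and> t \<noteq> 0)"
  have t: "v (t v) = 1 \<and> t v \<noteq> 0" if "v \<in> T" for v
    unfolding t_def by (rule someI_ex) (use ex_pt_eq_1[of v] that T in blast)
  define g where "g = (\<lambda>(v, i, s). s * t v ^ i)"
  \<comment> \<open>The precision must outweigh poles that a local element \<open>g p\<close> may
    have at other points of \<open>T\<close>: \<open>N + w (g p) \<ge> w x\<close> is required for
    all \<open>w\<close> in \<open>T\<close>.\<close>
  define N where "N = nat (\<Sum>p\<in>T \<times> I. \<bar>fst p x\<bar> + \<bar>fst p (g (snd p))\<bar>)"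
  have N: "w x \<le> int N + w (g p)" if "w \<in> T" "p \<in> I" for w p
  proof -
    have "\<bar>w x\<bar> + \<bar>w (g p)\<bar> \<le> (\<Sum>p\<in>T \<times> I. \<bar>fst p x\<bar> + \<bar>fst p (g (snd p))\<bar>)"
      using member_le_sum[of "(w, p)" "T \<times> I" "\<lambda>p. \<bar>fst p x\<bar> + \<bar>fst p (g (snd p))\<bar>"] that T finI
      by auto
    thus ?thesis unfolding N_def by linarith
  qed
  have "\<exists>h. \<forall>v\<in>T. vge v (int N) (h v - 1) \<and> (\<forall>w\<in>T - {v}. vge w (int N) (h v))"
    using approximation[of _ "T - {_}" N] T by (intro bchoice) blast
  then obtain h where h: "\<And>v. v \<in> T \<Longrightarrow> vge v (int N) (h v - 1)"
    "\<And>v w. v \<in> T \<Longrightarrow> w \<in> T \<Longrightarrow> w \<noteq> v \<Longrightarrow> vge w (int N) (h v)" by blast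
  define z where "z = (\<lambda>p. h (fst p) * g p)"
  have x0: "x \<noteq> 0"
  proof
    assume "x = 0"
    have "T = {}" using zeros T pt_zero \<open>x = 0\<close> by fastforce
    thus False using \<open>m < card I\<close> by (simp add: I_def)
  qed
  have "poly_dependent x I z" by (rule dep_reindex[OF m finI \<open>m < card I\<close>])
  then obtain a w L where a: "\<exists>i\<in>I. a i \<noteq> 0" and w: "\<And>i. w i \<in> polys x L"
    and eq: "(\<Sum>i\<in>I. (\<iota> (a i) + x * w i) * z i) = 0"
    by (rule dep_normal_form[OF _ x0]) blast
  obtain v i0 s0 where p0: "(v, i0, s0) \<in> I" "a (v, i0, s0) \<noteq> 0" using a by (metis prod_cases3)
  have vT: "v \<in> T" using p0 by (simp add: I_def)
  have v: "v \<in> points \<iota>" using vT T by blast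
  define e where "e = nat (v x)"
  have e: "int e = v x" using zeros[OF vT] by (simp add: e_def)
  have g0: "vge v 0 (g p)" if "p \<in> I" "fst p = v" for p
  proof -
    obtain u i s where "p = (u, i, s)" by (cases p)
    hence p: "p = (v, i, s)" "s \<in> rbasis v" using that unfolding I_def by auto
    have "vge v 0 (t v ^ i)" using t[OF vT] pt_power[OF v] by (simp add: vge_def)
    thus ?thesis unfolding p g_def using rbasis_vge[OF v p(2)] by (auto intro: vge_mult_left[OF v])
  qed
  have Ng: "vge v (int e) (c * g p)" if "vge v (int N) c" "p \<in> I" for c p
    using vge_mono[OF vge_mult[OF v that(1) vge_self, of "g p"], of "int e"] N[OF vT that(2)] e by simp
  have z_off: "vge v (int e) (z p)" if "p \<in> I" "fst p \<noteq> v" for p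
    unfolding z_def using that vT by (intro Ng h) (auto simp: I_def)
  have z_on: "vge v (int e) (z p - g p)" if "p \<in> I" "fst p = v" for p
  proof -
    have "z p - g p = (h v - 1) * g p" using that by (simp add: z_def algebra_simps)
    thus ?thesis using Ng[OF h(1)[OF vT] that(1)] by simp
  qed
  have z0: "vge v 0 (z p)" if "p \<in> I" for p
  proof (cases "fst p = v")
    case True
    have "vge v 0 (z p - g p + g p)"
      by (rule vge_add[OF v vge_mono[OF z_on[OF that True]] g0[OF that True]]) simp
    thus ?thesis by simp
  next
    case False
    show ?thesis by (rule vge_mono[OF z_off[OF that False]]) simp
  qed
  define J where "J = {p \<in> I. fst p = v}"
  have J: "J = {v} \<times> ({..<e} \<times> rbasis v)" using vT by (auto simp: J_def I_def e_def)
  \<comment> \<open>The relation solved for the local elements at \<open>v\<close>. On the right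
    each sum has order at least \<open>e\<close>: the first by its factor \<open>x\<close>, the
    second because \<open>h v\<close> is near 1, the third because the other \<open>h\<close> are
    near 0.\<close>
  have "(\<Sum>p\<in>J. \<iota> (a p) * g p) = - (\<Sum>p\<in>I. x * (w p * z p)) - (\<Sum>p\<in>J. \<iota> (a p) * (z p - g p))
      - (\<Sum>p\<in>I - J. \<iota> (a p) * z p)"
  proof -
    have "(\<Sum>p\<in>I. \<iota> (a p) * z p) + (\<Sum>p\<in>I. x * (w p * z p)) = 0"
      using eq by (simp add: distrib_right sum.distrib mult.assoc)
    moreover have "(\<Sum>p\<in>I. \<iota> (a p) * z p) = (\<Sum>p\<in>I - J. \<iota> (a p) * z p) + (\<Sum>p\<in>J. \<iota> (a p) * z p)"
      using finI by (intro sum.subset_diff) (auto simp: J_def)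
    moreover have "(\<Sum>p\<in>J. \<iota> (a p) * z p) = (\<Sum>p\<in>J. \<iota> (a p) * g p) + (\<Sum>p\<in>J. \<iota> (a p) * (z p - g p))"
      by (simp add: sum.distrib[symmetric] algebra_simps)
    ultimately show ?thesis by (simp add: algebra_simps eq_neg_iff_add_eq_0)
  qed
  moreover have "vge v (int e) (\<Sum>p\<in>I. x * (w p * z p))"
  proof (rule vge_sum[OF v])
    fix p assume "p \<in> I"
    have "vge v 0 (w p)" by (rule vge_polys[OF v _ w]) (use e in \<open>simp add: vge_def\<close>)
    hence "vge v 0 (w p * z p)" using z0[OF \<open>p \<in> I\<close>] by (rule vge_mult_left[OF v])
    moreover have "vge v (int e) x" by (simp add: vge_def e)
    ultimately show "vge v (int e) (x * (w p * z p))"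
      using vge_mult[OF v, of "int e" x 0 "w p * z p"] by simp
  qed
  moreover have "vge v (int e) (\<Sum>p\<in>J. \<iota> (a p) * (z p - g p))"
    by (intro vge_sum[OF v] vge_scale[OF v] z_on) (auto simp: J_def)
  moreover have "vge v (int e) (\<Sum>p\<in>I - J. \<iota> (a p) * z p)"
    by (intro vge_sum[OF v] vge_scale[OF v] z_off) (auto simp: J_def)
  ultimately have "vge v (int e) (\<Sum>p\<in>J. \<iota> (a p) * g p)"
    by (simp add: vge_diff[OF v] vge_minus[OF v])
  also have "(\<Sum>p\<in>J. \<iota> (a p) * g p) = (\<Sum>i<e. \<Sum>s\<in>rbasis v. \<iota> (a (v, i, s)) * (s * t v ^ i))"
  proof -
    have "(\<Sum>p\<in>J. \<iota> (a p) * g p) = (\<Sum>(i, s)\<in>{..<e} \<times> rbasis v. \<iota> (a (v, i, s)) * (s * t v ^ i))"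
      unfolding J by (rule sum.reindex_bij_witness[of _ "\<lambda>q. (v, q)" snd]) (auto simp: g_def)
    thus ?thesis by (simp add: sum.cartesian_product)
  qed
  finally have "a (v, i0, s0) = 0"
    using expansion_independent[OF v, of "t v" e "\<lambda>i s. a (v, i, s)" i0 s0] t[OF vT] p0(1)
    by (simp add: I_def e_def)
  thus False using p0(2) by simp
qed

text \<open>Each zero contributes at least 1 to the sum bounded by
  \<open>zeros_degree_le\<close>.\<close>

lemma finite_zeros:
  assumes "x \<noteq> 0"
  shows "finite {v \<in> points \<iota>. 0 < v x}"
proof (rule ccontr)
  assume inf: "infinite {v \<in> points \<iota>. 0 < v x}"
  obtain m where m: "\<forall>z :: nat \<Rightarrow> 'f. poly_dependent x {..m} z" using ex_rank_bound by blast
  obtain T where T: "T \<subseteq> {v \<in> points \<iota>. 0 < v x}" "finite T" "card T = Suc m"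
    using infinite_arbitrarily_large[OF inf, of "Suc m"] by blast
  have "(\<Sum>v\<in>T. 1) \<le> (\<Sum>v\<in>T. nat (v x) * point_degree \<iota> v)"
  proof (rule sum_mono)
    fix v assume "v \<in> T"
    hence "0 < nat (v x)" "0 < point_degree \<iota> v" using T(1) point_degree_pos by auto
    thus "1 \<le> nat (v x) * point_degree \<iota> v" by simp
  qed
  also have "\<dots> \<le> m" using T by (intro zeros_degree_le[OF m]) auto
  finally show False using T(3) by simp
qed

lemma finite_support:
  assumes "x \<noteq> 0"
  shows "finite {v \<in> points \<iota>. v x \<noteq> 0}"
proof -
  have "{v \<in> points \<iota>. v x \<noteq> 0} = {v \<in> points \<iota>. 0 < v x} \<union> {v \<in> points \<iota>. 0 < v (inverse x)}"
    by (auto simp: pt_inverse)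
  thus ?thesis using finite_zeros[of x] finite_zeros[of "inverse x"] assms by simp
qed

section \<open>Divisors and Riemann-Roch spaces\<close>

abbreviation "deg \<equiv> divisor_degree \<iota>"
abbreviation "L \<equiv> RR_space \<iota>"
abbreviation "dimL \<equiv> RR_dim \<iota>"

lemma lookup_outside: "D \<in> divisors \<iota> \<Longrightarrow> v \<notin> points \<iota> \<Longrightarrow> Poly_Mapping.lookup D v = 0"
  unfolding divisors_def by (auto simp: in_keys_iff)

lemma divisorsI: "(\<And>v. v \<notin> points \<iota> \<Longrightarrow> Poly_Mapping.lookup D v = 0) \<Longrightarrow> D \<in> divisors \<iota>"
  unfolding divisors_def using in_keys_iff by fastforce

lemma divisors_zero: "0 \<in> divisors \<iota>"
  and divisors_add: "D \<in> divisors \<iota> \<Longrightarrow> E \<in> divisors \<iota> \<Longrightarrow> D + E \<in> divisors \<iota>"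
  and divisors_minus: "D \<in> divisors \<iota> \<Longrightarrow> - D \<in> divisors \<iota>"
  and divisors_diff: "D \<in> divisors \<iota> \<Longrightarrow> E \<in> divisors \<iota> \<Longrightarrow> D - E \<in> divisors \<iota>"
  and divisors_multiple: "v \<in> points \<iota> \<Longrightarrow> multiple i v \<in> divisors \<iota>"
  by (auto intro!: divisorsI simp: lookup_add lookup_minus multiple_def lookup_single
      lookup_outside when_def)

lemma deg_eq_sum:
  assumes "finite T" "Poly_Mapping.keys D \<subseteq> T"
  shows "deg D = (\<Sum>v\<in>T. Poly_Mapping.lookup D v * int (point_degree \<iota> v))"
  unfolding divisor_degree_def using assms
  by (intro sum.mono_neutral_left) (auto simp: in_keys_iff)

lemma deg_add: "deg (D + E) = deg D + deg E"
proof -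
  define T where "T = Poly_Mapping.keys D \<union> Poly_Mapping.keys E"
  have T: "finite T" "Poly_Mapping.keys D \<subseteq> T" "Poly_Mapping.keys E \<subseteq> T" "Poly_Mapping.keys (D + E) \<subseteq> T"
    unfolding T_def using keys_add[of D E] by auto
  show ?thesis
    unfolding deg_eq_sum[OF T(1,2)] deg_eq_sum[OF T(1,3)] deg_eq_sum[OF T(1,4)]
    by (simp add: lookup_add distrib_right sum.distrib)
qed

lemma deg_zero: "deg 0 = 0"
  using deg_add[of 0 0] by simp

lemma deg_minus: "deg (- D) = - deg D"
  using deg_add[of D "- D"] deg_zero by simp

lemma deg_diff: "deg (D - E) = deg D - deg E"
  using deg_add[of D "- E"] by (simp add: deg_minus)

lemma deg_multiple: "deg (multiple i v) = i * int (point_degree \<iota> v)"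
  by (subst deg_eq_sum[of "{v}"]) (auto simp: multiple_def)

lemma deg_sum_const: "deg (\<Sum>i<n::nat. D) = int n * deg D"
  by (induction n) (auto simp: deg_zero deg_add algebra_simps)

lemma lookup_sum_const: "Poly_Mapping.lookup (\<Sum>i<n::nat. D) v = int n * Poly_Mapping.lookup D v"
  for D :: "'f divisor"
  by (induction n) (auto simp: lookup_add algebra_simps)

section \<open>Effective divisors and divisors of functions\<close>

definition effective :: "'f divisor \<Rightarrow> bool" where
  "effective D \<longleftrightarrow> D \<in> divisors \<iota> \<and> (\<forall>v. 0 \<le> Poly_Mapping.lookup D v)"

lemma effectiveD: "effective D \<Longrightarrow> D \<in> divisors \<iota>"
  by (simp add: effective_def)

lemma effectiveI:
  assumes "D \<in> divisors \<iota>" "\<And>v. v \<in> points \<iota> \<Longrightarrow> 0 \<le> Poly_Mapping.lookup D v"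
  shows "effective D"
  unfolding effective_def using assms lookup_outside[OF assms(1)] by (metis order_refl)

lemma effective_zero: "effective 0"
  by (simp add: effective_def divisors_zero)

lemma effective_add: "effective D \<Longrightarrow> effective E \<Longrightarrow> effective (D + E)"
  by (simp add: effective_def divisors_add lookup_add)

lemma effective_sum_const: "effective D \<Longrightarrow> effective (\<Sum>i<n::nat. D)"
  by (induction n) (auto intro: effective_zero effective_add)

lemma effective_deg: "effective D \<Longrightarrow> 0 \<le> deg D"
  unfolding divisor_degree_def effective_def by (intro sum_nonneg) auto

definition pos_part :: "'f divisor \<Rightarrow> 'f divisor" where
  "pos_part D = Poly_Mapping.map (max 0) D"

lemma lookup_pos_part: "Poly_Mapping.lookup (pos_part D) v = max 0 (Poly_Mapping.lookup D v)"
  by (simp add: pos_part_def map.rep_eq when_def)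

lemma effective_pos_part: "D \<in> divisors \<iota> \<Longrightarrow> effective (pos_part D)"
  by (auto intro!: effectiveI divisorsI simp: lookup_pos_part lookup_outside)

lemma effective_pos_part_diff: "D \<in> divisors \<iota> \<Longrightarrow> effective (pos_part D - D)"
  by (auto intro!: effectiveI divisors_diff effectiveD[OF effective_pos_part]
      simp: lookup_pos_part lookup_minus)

text \<open>The restriction to points keeps the support finite, since arbitrary integer-valued
  functions share the type of points.\<close>

definition div_of :: "'f \<Rightarrow> 'f divisor" where
  "div_of x = Abs_poly_mapping (\<lambda>v. if v \<in> points \<iota> then v x else 0)"

lemma lookup_div_of:
  assumes "x \<noteq> 0"
  shows "Poly_Mapping.lookup (div_of x) v = (if v \<in> points \<iota> then v x else 0)"
proof -
  have "{v. (if v \<in> points \<iota> then v x else 0) \<noteq> 0} = {v \<in> points \<iota>. v x \<noteq> 0}" by auto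
  thus ?thesis unfolding div_of_def using finite_support[OF assms]
    by (subst lookup_Abs_poly_mapping) auto
qed

lemma div_of_in_divisors: "x \<noteq> 0 \<Longrightarrow> div_of x \<in> divisors \<iota>"
  by (rule divisorsI) (simp add: lookup_div_of)

lemma RR_iff: "f \<in> L E \<longleftrightarrow> (\<forall>v\<in>points \<iota>. vge v (- Poly_Mapping.lookup E v) f)"
  unfolding RR_space_def vge_def by (cases "f = 0") (auto simp: neg_le_iff_le algebra_simps)

lemma zero_in_RR: "0 \<in> L E"
  by (simp add: RR_iff vge_zero)

lemma subspace_RR: "vs.subspace (L E)"
  unfolding vs.subspace_def Ball_def RR_iff by (auto intro: vge_zero vge_add vge_scale)

lemma RR_mono: "effective A \<Longrightarrow> L D \<subseteq> L (D + A)"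
  unfolding RR_iff subset_iff effective_def lookup_add by (force intro: vge_mono)

lemma RR_zero: "L 0 = range \<iota>"
proof
  show "L 0 \<subseteq> range \<iota>"
  proof
    fix f assume f: "f \<in> L 0"
    show "f \<in> range \<iota>"
    proof (rule ccontr)
      assume "f \<notin> range \<iota>"
      moreover from this obtain v where "v \<in> points \<iota>" "v f < 0" using ex_pole by blast
      ultimately show False using f hom_zero by (auto simp: RR_iff vge_def)
    qed
  qed
qed (auto simp: RR_iff vge_const)

section \<open>Counting Riemann-Roch spaces\<close>

lemma card_le_card_fibres:
  fixes V W :: "'f set" and \<phi> :: "'f \<Rightarrow> 'r"
  assumes "finite W" "finite R" "\<And>a. a \<in> V \<Longrightarrow> \<phi> a \<in> R"
    and "\<And>a b. a \<in> V \<Longrightarrow> b \<in> V \<Longrightarrow> \<phi> a = \<phi> b \<Longrightarrow> a - b \<in> W"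
  shows "finite V \<and> card V \<le> card R * card W"
proof -
  define \<sigma> where "\<sigma> = (\<lambda>r. SOME a. a \<in> V \<and> \<phi> a = r)"
  have \<sigma>: "\<sigma> (\<phi> a) \<in> V \<and> \<phi> (\<sigma> (\<phi> a)) = \<phi> a" if "a \<in> V" for a
    unfolding \<sigma>_def by (rule someI_ex) (use that in blast)
  define F where "F = (\<lambda>a. (\<phi> a, a - \<sigma> (\<phi> a)))"
  have inj: "inj_on F V" by (rule inj_onI) (auto simp: F_def)
  have sub: "F ` V \<subseteq> R \<times> W" unfolding F_def using assms(3,4) \<sigma> by auto
  have "finite V" using inj sub assms(1,2) by (metis finite_imageD finite_SigmaI finite_subset)
  moreover have "card V \<le> card (R \<times> W)" using inj sub assms(1,2) by (intro card_inj_on_le) auto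
  ultimately show ?thesis by (simp add: card_cartesian_product)
qed

lemma ex_pt_eq:
  assumes "v \<in> points \<iota>"
  obtains u where "v u = n" "u \<noteq> 0"
proof -
  have "surj v" using assms unfolding points_def by simp
  then obtain u where u: "v u = n" by (metis surjD)
  show ?thesis
  proof (cases "u = 0")
    case True
    thus ?thesis using that[of 1] u pt_zero[OF assms] pt_one[OF assms] by simp
  qed (use that u in blast)
qed

text \<open>Multiplication by \<open>u\<close>, of order \<open>lookup D Q + 1\<close>, makes
  functions in \<open>L(D + Q)\<close> regular at \<open>Q\<close>; two of them with the same
  residue there differ by an element of \<open>L(D)\<close>. Counting fibres replaces the quotient
  space.\<close>

lemma RR_card_step:
  assumes Q: "Q \<in> points \<iota>" and fin: "finite (L D)"
  shows "finite (L (D + multiple 1 Q)) \<and>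
    card (L (D + multiple 1 Q)) \<le> CARD('k) ^ point_degree \<iota> Q * card (L D)"
proof -
  define n where "n = Poly_Mapping.lookup D Q + 1"
  obtain u where u: "Q u = n" "u \<noteq> 0" using ex_pt_eq[OF Q] by blast
  define \<phi> where "\<phi> = (\<lambda>f. SOME r. r \<in> residues Q \<and> vge Q 1 (f * u - r))"
  have lk: "Poly_Mapping.lookup (D + multiple 1 Q) v = Poly_Mapping.lookup D v + (if v = Q then 1 else 0)" for v
    by (simp add: lookup_add multiple_def lookup_single when_def)
  have \<phi>: "\<phi> f \<in> residues Q \<and> vge Q 1 (f * u - \<phi> f)" if "f \<in> L (D + multiple 1 Q)" for f
  proof -
    have "vge Q (- n) f" using that Q lk[of Q] by (auto simp: RR_iff n_def)
    hence "vge Q 0 (f * u)" using vge_mult[OF Q, of "- n" f n u] u by (simp add: vge_def)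
    hence "\<exists>r. r \<in> residues Q \<and> vge Q 1 (f * u - r)" using ex_residue[OF Q] by blast
    thus ?thesis unfolding \<phi>_def by (rule someI_ex)
  qed
  have "a - b \<in> L D"
    if ab: "a \<in> L (D + multiple 1 Q)" "b \<in> L (D + multiple 1 Q)" "\<phi> a = \<phi> b" for a b
    unfolding RR_iff
  proof
    fix v assume v: "v \<in> points \<iota>"
    show "vge v (- Poly_Mapping.lookup D v) (a - b)"
    proof (cases "v = Q")
      case True
      have "vge Q 1 ((a * u - \<phi> a) - (b * u - \<phi> b))"
        using \<phi>[OF ab(1)] \<phi>[OF ab(2)] by (intro vge_diff[OF Q, of 1 "a * u - \<phi> a" "b * u - \<phi> b"]) auto
      hence "vge Q 1 ((a - b) * u)" using ab(3) by (simp add: left_diff_distrib)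
      hence "a - b = 0 \<or> 1 \<le> Q (a - b) + n"
        using u pt_mult[OF Q, of "a - b" u] by (cases "a = b") (auto simp: vge_def)
      thus ?thesis using True by (auto simp: vge_def n_def)
    next
      case False
      thus ?thesis using ab(1,2) v lk[of v] by (auto simp: RR_iff intro!: vge_diff)
    qed
  qed
  with card_le_card_fibres[OF fin card_residues(1)[OF Q], of "L (D + multiple 1 Q)" \<phi>]
  show ?thesis using \<phi> card_residues(2)[OF Q] by simp
qed

lemma RR_card_le:
  assumes fin: "finite (L D)"
  shows "effective A \<Longrightarrow>
    finite (L (D + A)) \<and> card (L (D + A)) \<le> CARD('k) ^ nat (deg A) * card (L D)"
proof (induction "nat (deg A)" arbitrary: A rule: less_induct)
  case less
  show ?case
  proof (cases "A = 0")
    case True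
    thus ?thesis using fin by (simp add: deg_zero)
  next
    case False
    then obtain Q where Q: "Q \<in> Poly_Mapping.keys A" by (metis keys_eq_empty equals0I)
    have Qp: "Q \<in> points \<iota>" using Q less.prems unfolding effective_def divisors_def by blast
    define A' where "A' = A - multiple 1 Q"
    have A: "A = A' + multiple 1 Q" by (simp add: A'_def)
    have "Poly_Mapping.lookup A Q \<noteq> 0" using Q by (simp add: in_keys_iff)
    moreover have "0 \<le> Poly_Mapping.lookup A Q" using less.prems by (simp add: effective_def)
    ultimately have "1 \<le> Poly_Mapping.lookup A Q" by simp
    hence eff: "effective A'"
      unfolding A'_def using less.prems divisors_multiple[OF Qp]
      by (auto intro!: effectiveI divisors_diff
          simp: effective_def lookup_minus multiple_def lookup_single when_def)
    have degA: "deg A = deg A' + int (point_degree \<iota> Q)" by (subst A) (simp add: deg_add deg_multiple)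
    hence degn: "nat (deg A) = point_degree \<iota> Q + nat (deg A')"
      using effective_deg[OF eff] by (simp add: nat_add_distrib)
    hence "nat (deg A') < nat (deg A)" using point_degree_pos[OF Qp] by simp
    from less.hyps[OF this eff]
    have IH: "finite (L (D + A'))" "card (L (D + A')) \<le> CARD('k) ^ nat (deg A') * card (L D)" by auto
    have DA: "D + A = D + A' + multiple 1 Q" by (simp add: A add.assoc)
    have "finite (L (D + A)) \<and> card (L (D + A)) \<le> CARD('k) ^ point_degree \<iota> Q * card (L (D + A'))"
      unfolding DA by (rule RR_card_step[OF Qp IH(1)])
    moreover have "CARD('k) ^ point_degree \<iota> Q * card (L (D + A'))
      \<le> CARD('k) ^ nat (deg A) * card (L D)"
      unfolding degn power_add mult.assoc by (rule mult_left_mono[OF IH(2)]) simp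
    ultimately show ?thesis by linarith
  qed
qed

lemma finite_RR:
  assumes "D \<in> divisors \<iota>"
  shows "finite (L D)"
proof -
  have "finite (L (0 + pos_part D))"
    using RR_card_le[of 0 "pos_part D"] effective_pos_part[OF assms] by (simp add: RR_zero)
  moreover have "L D \<subseteq> L (D + (pos_part D - D))" by (rule RR_mono[OF effective_pos_part_diff[OF assms]])
  ultimately show ?thesis by (simp add: finite_subset)
qed

lemma card_RR:
  assumes "D \<in> divisors \<iota>"
  shows "card (L D) = CARD('k) ^ dimL D"
proof -
  obtain B where B: "B \<subseteq> L D" "vs.independent B" "L D \<subseteq> vs.span B" "card B = vs.dim (L D)"
    using vs.basis_exists[of "L D"] by blast
  have "vs.span B = L D" using B vs.span_minimal[OF B(1) subspace_RR] by blast
  moreover have "finite B" using B(1) finite_RR[OF assms] finite_subset by blast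
  ultimately show ?thesis using card_span[OF _ B(2)] B(4) unfolding RR_dim_def by simp
qed

lemma dimL_le_iff:
  assumes "D \<in> divisors \<iota>" "E \<in> divisors \<iota>"
  shows "dimL D \<le> dimL E \<longleftrightarrow> card (L D) \<le> card (L E)"
  using card_field_gt_1 by (simp add: card_RR assms)

lemma dimL_eq_iff:
  assumes "D \<in> divisors \<iota>" "E \<in> divisors \<iota>"
  shows "dimL D = dimL E \<longleftrightarrow> card (L D) = card (L E)"
  using card_field_gt_1 by (simp add: card_RR assms)

lemma dimL_zero: "dimL 0 = 1"
proof -
  have "card (L 0) = CARD('k) ^ 1" unfolding RR_zero using card_image[OF hom_inj] by simp
  thus ?thesis using card_field_gt_1 card_RR[OF divisors_zero] by (metis power_inject_exp)
qed

lemma dimL_add_le: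
  assumes "D \<in> divisors \<iota>" "effective A"
  shows "int (dimL (D + A)) \<le> int (dimL D) + deg A"
proof -
  have DA: "D + A \<in> divisors \<iota>" using assms by (simp add: divisors_add effectiveD)
  have "CARD('k) ^ dimL (D + A) \<le> CARD('k) ^ (nat (deg A) + dimL D)"
    using RR_card_le[OF finite_RR[OF assms(1)] assms(2)]
    by (simp add: card_RR assms(1) DA power_add)
  hence "dimL (D + A) \<le> nat (deg A) + dimL D" using card_field_gt_1 by simp
  thus ?thesis using effective_deg[OF assms(2)] by linarith
qed

lemma RR_add_div_of:
  assumes "f \<noteq> 0"
  shows "g \<in> L (D + div_of f) \<longleftrightarrow> g * f \<in> L D"
proof -
  have "vge v (- Poly_Mapping.lookup (D + div_of f) v) g \<longleftrightarrow> vge v (- Poly_Mapping.lookup D v) (g * f)"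
    if v: "v \<in> points \<iota>" for v
  proof (cases "g = 0")
    case False
    thus ?thesis using assms v
      by (auto simp: vge_def lookup_add lookup_div_of pt_mult[OF v])
  qed (simp add: vge_zero)
  thus ?thesis unfolding RR_iff by auto
qed

lemma dimL_add_div_of:
  assumes "D \<in> divisors \<iota>" "f \<noteq> 0"
  shows "dimL (D + div_of f) = dimL D"
proof -
  have "bij_betw (\<lambda>g. g * f) (L (D + div_of f)) (L D)"
  proof (rule bij_betwI[of _ _ _ "\<lambda>g. g / f"])
    show "(\<lambda>g. g / f) \<in> L D \<rightarrow> L (D + div_of f)"
      using assms(2) by (auto simp: RR_add_div_of[OF assms(2)])
  qed (use assms(2) RR_add_div_of[OF assms(2)] in auto)
  hence "card (L (D + div_of f)) = card (L D)" by (rule bij_betw_same_card)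
  thus ?thesis using assms by (subst dimL_eq_iff) (auto intro: divisors_add div_of_in_divisors)
qed

section \<open>Principal divisors have degree zero\<close>

definition zero_div :: "'f \<Rightarrow> 'f divisor" where
  "zero_div x = pos_part (div_of x)"

lemma lookup_zero_div:
  "x \<noteq> 0 \<Longrightarrow> Poly_Mapping.lookup (zero_div x) v = (if v \<in> points \<iota> then max 0 (v x) else 0)"
  by (simp add: zero_div_def lookup_pos_part lookup_div_of)

lemma effective_zero_div: "x \<noteq> 0 \<Longrightarrow> effective (zero_div x)"
  by (simp add: zero_div_def effective_pos_part div_of_in_divisors)

lemma div_of_eq_zeros_minus_poles:
  assumes "x \<noteq> 0"
  shows "div_of x = zero_div x - zero_div (inverse x)"
  by (rule poly_mapping_eqI)
     (use assms in \<open>auto simp: lookup_minus lookup_zero_div lookup_div_of pt_inverse\<close>)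

text \<open>For nonconstant \<open>x\<close> this is \<open>[F : k(x)]\<close>, expressed without
  the subfield.\<close>

definition poly_rank :: "'f \<Rightarrow> nat" where
  "poly_rank x = (LEAST m. \<forall>z :: nat \<Rightarrow> 'f. poly_dependent x {..m} z)"

lemma rk_dep: "\<forall>z :: nat \<Rightarrow> 'f. poly_dependent x {..poly_rank x} z"
  unfolding poly_rank_def by (rule LeastI_ex[OF ex_rank_bound])

lemma ex_rk_not_dep: "\<exists>z :: nat \<Rightarrow> 'f. \<not> poly_dependent x {..<poly_rank x} z"
proof (cases "poly_rank x")
  case 0
  thus ?thesis by (simp add: poly_dependent_def)
next
  case (Suc r)
  have "\<not> (\<forall>z :: nat \<Rightarrow> 'f. poly_dependent x {..r} z)"
    using not_less_Least[of r "\<lambda>m. \<forall>z :: nat \<Rightarrow> 'f. poly_dependent x {..m} z"] Suc unfolding poly_rank_def by simp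
  thus ?thesis using Suc by (simp add: lessThan_Suc_atMost)
qed

text \<open>Reversing the coefficients turns a polynomial in \<open>y\<close> of degree below
  \<open>N\<close> into one in \<open>1/y\<close>, up to the common factor
  \<open>y ^ (N - 1)\<close>.\<close>

lemma dep_inverse:
  assumes "poly_dependent y I z" "y \<noteq> 0"
  shows "poly_dependent (inverse y) I z"
proof -
  obtain N c where c: "\<exists>i\<in>I. \<exists>j<N. c i j \<noteq> 0"
    "(\<Sum>i\<in>I. (\<Sum>j<N. \<iota> (c i j) * y ^ j) * z i) = 0"
    using assms(1) unfolding poly_dependent_def by blast
  obtain i0 j0 where ij: "i0 \<in> I" "j0 < N" "c i0 j0 \<noteq> 0" using c(1) by blast
  define d where "d = (\<lambda>i j. c i (N - 1 - j))"
  have eq: "(\<Sum>j<N. \<iota> (d i j) * inverse y ^ j) = inverse y ^ (N - 1) * (\<Sum>j<N. \<iota> (c i j) * y ^ j)" for i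
  proof -
    have "(\<Sum>j<N. \<iota> (d i j) * inverse y ^ j) = (\<Sum>j<N. \<iota> (c i j) * inverse y ^ (N - 1 - j))"
      by (rule sum.reindex_bij_witness[of _ "\<lambda>j. N - 1 - j" "\<lambda>j. N - 1 - j"]) (auto simp: d_def)
    also have "\<dots> = (\<Sum>j<N. inverse y ^ (N - 1) * (\<iota> (c i j) * y ^ j))"
    proof (rule sum.cong[OF refl])
      fix j assume "j \<in> {..<N}"
      hence "N - 1 = (N - 1 - j) + j" by auto
      hence "inverse y ^ (N - 1) = inverse y ^ (N - 1 - j) * inverse y ^ j" by (metis power_add)
      moreover have "inverse y ^ j * y ^ j = 1" using assms(2) by (simp add: power_inverse)
      ultimately show "\<iota> (c i j) * inverse y ^ (N - 1 - j) = inverse y ^ (N - 1) * (\<iota> (c i j) * y ^ j)"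
        by (simp add: mult.assoc mult.left_commute)
    qed
    finally show ?thesis by (simp only: sum_distrib_left)
  qed
  have "(\<Sum>i\<in>I. (\<Sum>j<N. \<iota> (d i j) * inverse y ^ j) * z i)
      = inverse y ^ (N - 1) * (\<Sum>i\<in>I. (\<Sum>j<N. \<iota> (c i j) * y ^ j) * z i)"
    unfolding eq sum_distrib_left[of _ _ I] by (simp only: mult.assoc)
  hence "(\<Sum>i\<in>I. (\<Sum>j<N. \<iota> (d i j) * inverse y ^ j) * z i) = 0" using c(2) by simp
  moreover have "\<exists>i\<in>I. \<exists>j<N. d i j \<noteq> 0"
    using ij by (intro bexI[of _ i0] exI[of _ "N - 1 - j0"]) (auto simp: d_def)
  ultimately show ?thesis unfolding poly_dependent_def by blast
qed

lemma rk_inverse: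
  assumes "y \<noteq> 0"
  shows "poly_rank (inverse y) = poly_rank y"
proof -
  have "poly_dependent (inverse y) I = (poly_dependent y I :: (nat \<Rightarrow> 'f) \<Rightarrow> bool)" for I
    using dep_inverse[of y I] dep_inverse[of "inverse y" I] assms by auto
  thus ?thesis unfolding poly_rank_def by simp
qed

lemma deg_zero_div_le:
  assumes "x \<noteq> 0"
  shows "deg (zero_div x) \<le> int (poly_rank x)"
proof -
  define T where "T = {v \<in> points \<iota>. 0 < v x}"
  have T: "finite T" unfolding T_def by (rule finite_zeros[OF assms])
  have "deg (zero_div x) = (\<Sum>v\<in>T. Poly_Mapping.lookup (zero_div x) v * int (point_degree \<iota> v))"
    using T by (intro deg_eq_sum) (auto simp: T_def in_keys_iff lookup_zero_div[OF assms] split: if_splits)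
  also have "\<dots> = int (\<Sum>v\<in>T. nat (v x) * point_degree \<iota> v)"
    by (simp add: T_def lookup_zero_div[OF assms])
  also have "(\<Sum>v\<in>T. nat (v x) * point_degree \<iota> v) \<le> poly_rank x"
    by (rule zeros_degree_le[OF rk_dep T]) (auto simp: T_def)
  finally show ?thesis by simp
qed

lemma ex_common_pole_bound:
  assumes "finite F"
  shows "\<exists>C. effective C \<and> F \<subseteq> L C"
  using assms
proof (induction F rule: finite_induct)
  case empty
  thus ?case using effective_zero by blast
next
  case (insert f F)
  then obtain C where C: "effective C" "F \<subseteq> L C" by blast
  obtain D where D: "effective D" "f \<in> L D"
  proof (cases "f = 0")
    case True
    thus ?thesis using that effective_zero zero_in_RR by blast
  next
    case False
    have "f \<in> L (zero_div (inverse f))"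
      unfolding RR_iff vge_def using False by (auto simp: lookup_zero_div pt_inverse)
    thus ?thesis using that effective_zero_div[of "inverse f"] False by auto
  qed
  have "f \<in> L (C + D)" using D RR_mono[OF C(1), of D] by (auto simp: add.commute)
  moreover have "F \<subseteq> L (C + D)" using C RR_mono[OF D(1), of C] by blast
  ultimately show ?case using effective_add[OF C(1) D(1)] by blast
qed

lemma nonconstant_nonzero: "y \<notin> range \<iota> \<Longrightarrow> y \<noteq> 0"
  using hom_zero by (metis rangeI)

text \<open>
  With \<open>u\<close> a family of \<open>poly_rank y\<close> elements that is independent over the polynomials in \<open>y\<close> and has
  poles bounded by \<open>C\<close>, the products \<open>y ^ j * u i\<close> with \<open>j \<le> l\<close> span a large subspace.
\<close>

lemma dimL_pole_multiples_ge:
  assumes y: "y \<notin> range \<iota>"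
  obtains C where "effective C"
    "\<And>l. poly_rank y * Suc l \<le> dimL ((\<Sum>i<l. zero_div (inverse y)) + C)"
proof -
  have y0: "y \<noteq> 0" using nonconstant_nonzero[OF y] .
  obtain u :: "nat \<Rightarrow> 'f" where u: "\<not> poly_dependent y {..<poly_rank y} u" using ex_rk_not_dep by blast
  obtain C where C: "effective C" "u ` {..<poly_rank y} \<subseteq> L C" using ex_common_pole_bound[of "u ` {..<poly_rank y}"] by auto
  define X where "X = zero_div (inverse y)"
  have X: "effective X" unfolding X_def using y0 by (intro effective_zero_div) simp
  have "poly_rank y * Suc l \<le> dimL ((\<Sum>i<l. X) + C)" for l
  proof -
    define D where "D = (\<Sum>i<l. X) + C"
    have D: "D \<in> divisors \<iota>" unfolding D_def
      by (intro effectiveD effective_add effective_sum_const X C(1))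
    define \<phi> where "\<phi> = (\<lambda>c. \<Sum>i<poly_rank y. (\<Sum>j<Suc l. \<iota> (c (i, j)) * y ^ j) * u i)"
    define T where "T = ({..<poly_rank y} \<times> {..<Suc l}) \<rightarrow>\<^sub>E (UNIV :: 'k set)"
    have mem: "y ^ j * u i \<in> L D" if "i < poly_rank y" "j < Suc l" for i j
      unfolding RR_iff
    proof
      fix v assume v: "v \<in> points \<iota>"
      have 1: "vge v (- Poly_Mapping.lookup C v) (u i)" using C(2) that v by (auto simp: RR_iff)
      have "int j * v y \<ge> - (int l * max 0 (- v y))"
      proof (cases "0 \<le> v y")
        case False
        have "int j * (- v y) \<le> int l * (- v y)" using that False by (intro mult_right_mono) auto
        thus ?thesis using False by simp
      qed simp
      hence 2: "vge v (- Poly_Mapping.lookup (\<Sum>i<l. X) v) (y ^ j)"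
        unfolding vge_def X_def lookup_sum_const
        using v y0 by (simp add: lookup_zero_div pt_inverse pt_power)
      show "vge v (- Poly_Mapping.lookup D v) (y ^ j * u i)"
        using vge_mult[OF v 2 1] by (simp add: D_def lookup_add)
    qed
    have "\<phi> c \<in> L D" for c
    proof -
      have "\<phi> c = (\<Sum>i<poly_rank y. \<Sum>j<Suc l. \<iota> (c (i, j)) * (y ^ j * u i))"
        unfolding \<phi>_def by (simp only: sum_distrib_right mult.assoc)
      also have "\<dots> \<in> L D"
        by (intro vs.subspace_sum[OF subspace_RR] vs.subspace_scale[OF subspace_RR] mem) auto
      finally show ?thesis .
    qed
    hence sub: "\<phi> ` T \<subseteq> L D" by blast
    have "inj_on \<phi> T"
    proof (rule inj_onI, rule ccontr)
      fix c c' assume cc: "c \<in> T" "c' \<in> T" "\<phi> c = \<phi> c'" "c \<noteq> c'"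
      have "\<exists>i\<in>{..<poly_rank y}. \<exists>j<Suc l. c (i, j) - c' (i, j) \<noteq> 0"
      proof (rule ccontr)
        assume "\<not> ?thesis"
        hence "c = c'" using cc(1,2) unfolding T_def by (intro PiE_ext[of c _ _ c']) auto
        with cc(4) show False by simp
      qed
      moreover have "(\<Sum>i<poly_rank y. (\<Sum>j<Suc l. \<iota> (c (i, j) - c' (i, j)) * y ^ j) * u i) = \<phi> c - \<phi> c'"
        unfolding \<phi>_def by (simp only: hom_diff left_diff_distrib sum_subtractf)
      ultimately have "poly_dependent y {..<poly_rank y} u" unfolding poly_dependent_def using cc(3)
        by (intro exI[of _ "Suc l"] exI[of _ "\<lambda>i j. c (i, j) - c' (i, j)"]) auto
      thus False using u by blast
    qed
    hence "card T \<le> card (L D)" using sub finite_RR[OF D] by (intro card_inj_on_le) auto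
    moreover have "card T = CARD('k) ^ (poly_rank y * Suc l)"
      unfolding T_def by (subst card_PiE) (auto simp: card_cartesian_product)
    ultimately show ?thesis unfolding D_def[symmetric] using card_field_gt_1 by (simp add: card_RR[OF D])
  qed
  thus ?thesis using that C(1) unfolding X_def by blast
qed

lemma deg_pole_div:
  assumes y: "y \<notin> range \<iota>"
  shows "deg (zero_div (inverse y)) = int (poly_rank y)"
proof (rule antisym)
  have y0: "y \<noteq> 0" using nonconstant_nonzero[OF y] .
  define X where "X = zero_div (inverse y)"
  have X: "effective X" unfolding X_def using y0 by (intro effective_zero_div) simp
  show "deg (zero_div (inverse y)) \<le> int (poly_rank y)"
    using deg_zero_div_le[of "inverse y"] y0 rk_inverse[OF y0] by simp
  obtain C where C: "effective C" "\<And>l. poly_rank y * Suc l \<le> dimL ((\<Sum>i<l. X) + C)"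
    using dimL_pole_multiples_ge[OF y] unfolding X_def by blast
  show "int (poly_rank y) \<le> deg (zero_div (inverse y))"
  proof (rule ccontr)
    assume "\<not> ?thesis"
    hence lt: "deg X + 1 \<le> int (poly_rank y)" by (simp add: X_def)
    \<comment> \<open>If the rank exceeded \<open>deg X\<close>, then rank times
      \<open>l + 1\<close> being at most \<open>1 + l * deg X + deg C\<close> would force
      \<open>deg X + l \<le> deg C\<close>, which this \<open>l\<close> violates.\<close>
    define l where "l = Suc (nat (deg C))"
    have eff: "effective ((\<Sum>i<l. X) + C)" by (intro effective_add effective_sum_const X C(1))
    have "int (poly_rank y * Suc l) \<le> int (dimL (0 + ((\<Sum>i<l. X) + C)))"
      using C(2)[of l] by (simp only: of_nat_le_iff add_0_left)
    also have "\<dots> \<le> 1 + (int l * deg X + deg C)"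
      using dimL_add_le[OF divisors_zero eff] by (simp add: dimL_zero deg_add deg_sum_const del: sum_constant)
    finally have 1: "int (poly_rank y) * (int l + 1) \<le> 1 + int l * deg X + deg C" by (simp add: algebra_simps)
    have "(deg X + 1) * (int l + 1) \<le> int (poly_rank y) * (int l + 1)"
      by (rule mult_right_mono[OF lt]) simp
    with 1 have "deg X + int l \<le> deg C" by (simp add: algebra_simps)
    thus False using effective_deg[OF X] effective_deg[OF C(1)] unfolding l_def by linarith
  qed
qed

text \<open>The zeros of \<open>x\<close> are the poles of \<open>1/x\<close>, and both pole
  divisors have the common rank as degree. Constants, which the pole formula does not cover, have
  divisor zero.\<close>

theorem deg_div_of:
  assumes "x \<noteq> 0"
  shows "deg (div_of x) = 0"
proof (cases "x \<in> range \<iota>")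
  case True
  then obtain a where "x = \<iota> a" by blast
  hence "div_of x = 0"
    by (intro poly_mapping_eqI) (use assms in \<open>auto simp: lookup_div_of pt_const\<close>)
  thus ?thesis by (simp add: deg_zero)
next
  case False
  have inv: "inverse x \<notin> range \<iota>"
  proof
    assume "inverse x \<in> range \<iota>"
    then obtain a where "inverse x = \<iota> a" by blast
    hence "x = \<iota> (inverse a)" by (metis hom_inverse inverse_inverse_eq)
    thus False using False by blast
  qed
  show ?thesis
    unfolding div_of_eq_zeros_minus_poles[OF assms] deg_diff
    using deg_pole_div[OF False] deg_pole_div[OF inv] rk_inverse[OF assms] by simp
qed

section \<open>Riemann's theorem\<close>

lemma ex_nonconstant: "\<exists>x. x \<notin> range \<iota>"
proof -
  obtain x where x: "\<not> algebraic_over \<iota> x" using finite_over_rational by blast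
  have "algebraic_over \<iota> (\<iota> a)" for a
  proof -
    have "eval_in \<iota> [:- a, 1:] (\<iota> a) = 0"
      by (subst eval_in_eq_sum[of _ 2]) (auto simp: numeral_2_eq_2 hom_minus hom_one)
    thus ?thesis unfolding algebraic_over_def by (intro exI[of _ "[:- a, 1:]"]) simp
  qed
  thus ?thesis using x by (metis imageE)
qed

lemma rk_pos:
  assumes "y \<notin> range \<iota>"
  shows "0 < poly_rank y"
proof (rule ccontr)
  assume "\<not> ?thesis"
  hence "poly_dependent y {..0::nat} (\<lambda>_. 1)" using rk_dep[of y] by simp
  then obtain N c where "\<exists>j<N. c (0::nat) j \<noteq> 0" "(\<Sum>j<N. \<iota> (c 0 j) * y ^ j) = 0"
    unfolding poly_dependent_def by auto
  thus False using nonconstant_independent[OF assms] by blast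
qed

text \<open>Adding an effective divisor never decreases \<open>deg - dim\<close>, and adding a
  principal one preserves it. On multiples of the pole divisor \<open>X\<close> it is bounded by the
  growth of their spaces, and the positive part of any \<open>A\<close> is equivalent to a divisor
  below such a multiple.\<close>

lemma riemann_inequality: "\<exists>\<gamma>. \<forall>A\<in>divisors \<iota>. deg A - int (dimL A) \<le> \<gamma>"
proof -
  obtain x where x: "x \<notin> range \<iota>" using ex_nonconstant by blast
  define X where "X = zero_div (inverse x)"
  have X: "effective X" unfolding X_def using nonconstant_nonzero[OF x] by (intro effective_zero_div) simp
  have degX: "1 \<le> deg X" unfolding X_def using deg_pole_div[OF x] rk_pos[OF x] by simp
  obtain C where C: "effective C" "\<And>l. poly_rank x * Suc l \<le> dimL ((\<Sum>i<l. X) + C)"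
    using dimL_pole_multiples_ge[OF x] unfolding X_def by blast
  define M where "M = (\<lambda>l::nat. \<Sum>i<l. X)"
  have M: "effective (M l)" "M l \<in> divisors \<iota>" "deg (M l) = int l * deg X" for l
    unfolding M_def using effective_sum_const[OF X] by (auto intro: effectiveD simp: deg_sum_const simp del: sum_constant)
  define \<gamma> where "\<gamma> = deg C"
  have lM: "deg (M l) - int (dimL (M l)) \<le> \<gamma>" for l
  proof -
    have "int (poly_rank x * Suc l) \<le> int (dimL (M l + C))"
      using C(2)[of l] unfolding M_def by (simp only: of_nat_le_iff)
    also have "\<dots> \<le> int (dimL (M l)) + deg C" by (rule dimL_add_le[OF M(2) C(1)])
    finally have "int l * deg X + deg X \<le> int (dimL (M l)) + deg C"
      using deg_pole_div[OF x] by (simp add: X_def algebra_simps)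
    thus ?thesis using degX M(3)[of l] by (simp add: \<gamma>_def)
  qed
  have "deg A - int (dimL A) \<le> \<gamma>" if A: "A \<in> divisors \<iota>" for A
  proof -
    define A1 where "A1 = pos_part A"
    have A1: "effective A1" "effective (A1 - A)" "A1 \<in> divisors \<iota>"
      unfolding A1_def using effective_pos_part[OF A] effective_pos_part_diff[OF A] effectiveD by auto
    \<comment> \<open>Large enough that \<open>dimL (M l)\<close> exceeds \<open>deg A1\<close>,
      which leaves a nonzero function in \<open>L (M l - A1)\<close>.\<close>
    define l where "l = Suc (nat (\<gamma> + deg A1))"
    have D: "M l - A1 \<in> divisors \<iota>" by (rule divisors_diff[OF M(2) A1(3)])
    have "int l * 1 \<le> int l * deg X" by (rule mult_left_mono[OF degX]) simp
    moreover have "\<gamma> + deg A1 < int l" unfolding l_def by linarith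
    ultimately have "0 < int l * deg X - \<gamma> - deg A1" by linarith
    also have "\<dots> \<le> int (dimL (M l)) - deg A1" using lM[of l] M(3)[of l] by simp
    also have "\<dots> \<le> int (dimL (M l - A1))" using dimL_add_le[OF D A1(1)] by simp
    finally have "0 < dimL (M l - A1)" by simp
    hence "1 < card (L (M l - A1))" unfolding card_RR[OF D] by (rule one_less_power[OF card_field_gt_1])
    hence "\<not> L (M l - A1) \<subseteq> {0}" using card_mono[of "{0}" "L (M l - A1)"] by auto
    then obtain z where z: "z \<in> L (M l - A1)" "z \<noteq> 0" by blast
    define E where "E = A1 - div_of z"
    have E: "E \<in> divisors \<iota>" unfolding E_def by (intro divisors_diff A1 div_of_in_divisors z)
    have dE: "deg E = deg A1" unfolding E_def by (simp add: deg_diff deg_div_of[OF z(2)])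
    have "dimL A1 = dimL (E + div_of z)" by (simp add: E_def)
    hence lE: "dimL E = dimL A1" using dimL_add_div_of[OF E z(2)] by simp
    have eff: "effective (M l - E)"
    proof (rule effectiveI[OF divisors_diff[OF M(2) E]])
      fix v assume v: "v \<in> points \<iota>"
      thus "0 \<le> Poly_Mapping.lookup (M l - E) v"
        using z by (auto simp: RR_iff vge_def E_def lookup_minus lookup_div_of)
    qed
    have "int (dimL (M l)) \<le> int (dimL E) + deg (M l - E)"
      using dimL_add_le[OF E eff] by simp
    hence 1: "deg E - int (dimL E) \<le> \<gamma>" using lM[of l] by (simp add: deg_diff)
    have "int (dimL A1) \<le> int (dimL A) + deg (A1 - A)"
      using dimL_add_le[OF A A1(2)] by simp
    thus ?thesis using 1 dE lE by (simp add: deg_diff)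
  qed
  thus ?thesis by blast
qed

section \<open>Gaps at a rational point\<close>

text \<open>Integers bounded above have a maximum, so Riemann's inequality turns the supremum into a
  value attained at some divisor.\<close>

lemma genus_attained:
  obtains A where "A \<in> divisors \<iota>" "genus \<iota> = deg A - int (dimL A) + 1"
    "\<And>D. D \<in> divisors \<iota> \<Longrightarrow> deg D - int (dimL D) + 1 \<le> genus \<iota>"
proof -
  define f where "f = (\<lambda>A. deg A - int (dimL A) + 1)"
  obtain \<gamma> where \<gamma>: "\<And>A. A \<in> divisors \<iota> \<Longrightarrow> f A \<le> \<gamma>"
    using riemann_inequality unfolding f_def by (metis add_right_mono)
  obtain A where A: "A \<in> divisors \<iota>" "\<And>D. D \<in> divisors \<iota> \<Longrightarrow> nat (\<gamma> - f A) \<le> nat (\<gamma> - f D)"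
    using ex_has_least_nat[of "\<lambda>A. A \<in> divisors \<iota>" 0 "\<lambda>A. nat (\<gamma> - f A)"] divisors_zero by blast
  have max: "f D \<le> f A" if "D \<in> divisors \<iota>" for D
    using A(2)[OF that] \<gamma>[OF that] \<gamma>[OF A(1)] by linarith
  have "genus \<iota> = f A"
    unfolding genus_def f_def[symmetric] by (rule cSup_eq_maximum) (use A(1) max in auto)
  thus ?thesis using that[OF A(1)] max unfolding f_def by simp
qed

lemma RR_eq_zero_if_deg_neg:
  assumes "D \<in> divisors \<iota>" "deg D < 0"
  shows "L D = {0}"
proof (rule ccontr)
  assume "L D \<noteq> {0}"
  then obtain f where f: "f \<in> L D" "f \<noteq> 0" using zero_in_RR[of D] by blast
  have "effective (D + div_of f)"
    by (rule effectiveI) (use f assms in \<open>auto simp: divisors_add div_of_in_divisors lookup_add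
        lookup_div_of RR_iff vge_def\<close>)
  from effective_deg[OF this] show False using assms(2) by (simp add: deg_add deg_div_of[OF f(2)])
qed

lemma dimL_eq_zero_if_deg_neg:
  assumes "D \<in> divisors \<iota>" "deg D < 0"
  shows "dimL D = 0"
proof (rule ccontr)
  assume "dimL D \<noteq> 0"
  hence "1 < card (L D)" unfolding card_RR[OF assms(1)] by (intro one_less_power[OF card_field_gt_1]) simp
  thus False by (simp add: RR_eq_zero_if_deg_neg[OF assms])
qed

end

locale pointed_function_field = function_field \<iota>
  for \<iota> :: "'k::{field,finite} \<Rightarrow> 'f::field" +
  fixes P :: "'f point"
  assumes rational: "rational_point \<iota> P"
begin

lemma P_point: "P \<in> points \<iota>" and point_degree_P: "point_degree \<iota> P = 1"
  using rational by (auto simp: rational_point_def)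

lemma shift_in_divisors: "D \<in> divisors \<iota> \<Longrightarrow> D + multiple i P \<in> divisors \<iota>"
  by (simp add: divisors_add divisors_multiple P_point)

lemma deg_shift: "deg (D + multiple i P) = deg D + i"
  by (simp add: deg_add deg_multiple point_degree_P)

lemma shift_shift: "D + multiple i P + multiple j P = D + multiple (i + j) P"
  by (simp add: multiple_def single_add add.assoc)

lemma shift_minus: "D + multiple i P - multiple 1 P = D + multiple (i - 1) P"
  by (simp add: multiple_def single_diff algebra_simps)

lemma shift_zero: "D + multiple 0 P = D"
  by (simp add: multiple_def)

lemma lookup_shift:
  "Poly_Mapping.lookup (D + multiple i P) v = Poly_Mapping.lookup D v + (if v = P then i else 0)"
  by (simp add: lookup_add multiple_def lookup_single when_def)

definition nongap :: "'f divisor \<Rightarrow> bool" where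
  "nongap D \<longleftrightarrow> L D \<noteq> L (D - multiple 1 P)"

lemma minus_P_eq: "D - multiple 1 P = D + multiple (- 1) P"
  using shift_minus[of D 0] by (simp add: shift_zero)

text \<open>A function of \<open>L D\<close> escapes \<open>L (D - P)\<close> exactly by attaining
  the pole order allowed at \<open>P\<close>. In this form, multiplying functions gives closure
  under addition.\<close>

lemma nongap_iff: "nongap D \<longleftrightarrow> (\<exists>f\<in>L D. f \<noteq> 0 \<and> P f = - Poly_Mapping.lookup D P)"
proof -
  have "L (D - multiple 1 P) \<subseteq> L D"
    unfolding minus_P_eq
  proof (rule subsetI, unfold RR_iff lookup_shift, rule ballI)
    fix f v assume f: "\<forall>v\<in>points \<iota>. vge v (- (Poly_Mapping.lookup D v + (if v = P then - 1 else 0))) f"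
      and v: "v \<in> points \<iota>"
    show "vge v (- Poly_Mapping.lookup D v) f" by (rule vge_mono[OF bspec[OF f v]]) simp
  qed
  hence "nongap D \<longleftrightarrow> (\<exists>f\<in>L D. f \<notin> L (D - multiple 1 P))" unfolding nongap_def by blast
  moreover have "f \<notin> L (D - multiple 1 P) \<longleftrightarrow> f \<noteq> 0 \<and> P f = - Poly_Mapping.lookup D P" if f: "f \<in> L D" for f
  proof -
    have "f \<in> L (D - multiple 1 P) \<longleftrightarrow> vge P (1 - Poly_Mapping.lookup D P) f"
      using f P_point unfolding minus_P_eq RR_iff lookup_shift by auto
    moreover have "vge P (- Poly_Mapping.lookup D P) f" using f P_point by (simp add: RR_iff)
    ultimately show ?thesis by (auto simp: vge_def)
  qed
  ultimately show ?thesis by blast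
qed

lemma nongap_add:
  assumes "nongap D" "nongap E"
  shows "nongap (D + E)"
proof -
  obtain f g where f: "f \<in> L D" "f \<noteq> 0" "P f = - Poly_Mapping.lookup D P"
    and g: "g \<in> L E" "g \<noteq> 0" "P g = - Poly_Mapping.lookup E P"
    using assms unfolding nongap_iff by blast
  have "f * g \<in> L (D + E)"
    using f(1) g(1) vge_mult[of _ _ f _ g] unfolding RR_iff lookup_add by fastforce
  moreover have "P (f * g) = - Poly_Mapping.lookup (D + E) P"
    using f g by (simp add: pt_mult[OF P_point] lookup_add)
  ultimately show ?thesis unfolding nongap_iff using f g by (intro bexI[of _ "f * g"]) auto
qed

lemma dimL_shift_step:
  assumes D: "D \<in> divisors \<iota>"
  shows "dimL (D + multiple i P) =
    dimL (D + multiple (i - 1) P) + (if nongap (D + multiple i P) then 1 else 0)"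
proof -
  define D' where "D' = D + multiple (i - 1) P"
  have D': "D' \<in> divisors \<iota>" unfolding D'_def by (rule shift_in_divisors[OF D])
  have eq: "D + multiple i P = D' + multiple 1 P" by (simp add: D'_def shift_shift)
  have eff: "effective (multiple 1 P)"
    by (rule effectiveI[OF divisors_multiple[OF P_point]]) (simp add: multiple_def lookup_single when_def)
  have gap: "nongap (D' + multiple 1 P) \<longleftrightarrow> L (D' + multiple 1 P) \<noteq> L D'"
    unfolding nongap_def by simp
  have le: "dimL (D' + multiple 1 P) \<le> dimL D' + 1"
    using dimL_add_le[OF D' eff] by (simp add: deg_multiple point_degree_P)
  have ge: "dimL D' < dimL (D' + multiple 1 P)" if "L (D' + multiple 1 P) \<noteq> L D'"
  proof -
    have "L D' \<subset> L (D' + multiple 1 P)" using RR_mono[OF eff, of D'] that by blast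
    hence "card (L D') < card (L (D' + multiple 1 P))"
      by (rule psubset_card_mono[OF finite_RR[OF shift_in_divisors[OF D']]])
    thus ?thesis using dimL_le_iff[OF shift_in_divisors[OF D'] D'] by (simp add: not_le[symmetric])
  qed
  have "dimL (D' + multiple 1 P) = dimL D' + (if nongap (D' + multiple 1 P) then 1 else 0)"
  proof (cases "nongap (D' + multiple 1 P)")
    case True
    thus ?thesis using gap le ge by simp
  next
    case False
    hence "L (D' + multiple 1 P) = L D'" using gap by simp
    thus ?thesis using False by (simp add: RR_dim_def)
  qed
  thus ?thesis unfolding eq by (simp add: D'_def)
qed

text \<open>Above a divisor \<open>A\<close> that attains the genus, \<open>deg - dim + 1\<close>
  cannot grow further. For large \<open>n\<close>, \<open>D + nP\<close> lies above
  \<open>A - (z)\<close>, where the nonzero \<open>z\<close> in \<open>L(D - A + nP)\<close> exists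
  by Riemann's inequality.\<close>

lemma ex_dimL_shift:
  assumes D: "D \<in> divisors \<iota>"
  shows "\<exists>N. \<forall>n\<ge>N. int (dimL (D + multiple n P)) = deg D + n + 1 - genus \<iota>"
proof -
  obtain A where A: "A \<in> divisors \<iota>" "genus \<iota> = deg A - int (dimL A) + 1"
    "\<And>D. D \<in> divisors \<iota> \<Longrightarrow> deg D - int (dimL D) + 1 \<le> genus \<iota>" using genus_attained by blast
  have "int (dimL (D + multiple n P)) = deg D + n + 1 - genus \<iota>" if n: "genus \<iota> - deg (D - A) \<le> n" for n
  proof -
    define E where "E = D - A + multiple n P"
    have E: "E \<in> divisors \<iota>" unfolding E_def by (intro shift_in_divisors divisors_diff D A(1))
    have "0 < int (dimL E)" using A(3)[OF E] n by (simp add: E_def deg_shift)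
    hence "1 < card (L E)" unfolding card_RR[OF E] by (intro one_less_power[OF card_field_gt_1]) simp
    hence "\<not> L E \<subseteq> {0}" using card_mono[of "{0}" "L E"] by auto
    then obtain z where z: "z \<in> L E" "z \<noteq> 0" by blast
    define A' where "A' = A - div_of z"
    have A': "A' \<in> divisors \<iota>" unfolding A'_def by (intro divisors_diff A div_of_in_divisors z)
    have dA': "deg A' = deg A" by (simp add: A'_def deg_diff deg_div_of[OF z(2)])
    have lA': "dimL A' = dimL A" using dimL_add_div_of[OF A' z(2)] by (simp add: A'_def)
    define F where "F = D + multiple n P"
    have F: "F \<in> divisors \<iota>" unfolding F_def by (rule shift_in_divisors[OF D])
    have eff: "effective (F - A')"
    proof (rule effectiveI[OF divisors_diff[OF F A']])
      fix v assume v: "v \<in> points \<iota>"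
      have "vge v (- Poly_Mapping.lookup E v) z" using z(1) v by (simp add: RR_iff)
      thus "0 \<le> Poly_Mapping.lookup (F - A') v"
        using z(2) v by (auto simp: vge_def F_def E_def A'_def lookup_minus lookup_shift lookup_div_of)
    qed
    have "int (dimL F) \<le> int (dimL A') + deg (F - A')"
      using dimL_add_le[OF A' eff] by simp
    hence "genus \<iota> \<le> deg F - int (dimL F) + 1" using dA' lA' A(2) by (simp add: deg_diff)
    with A(3)[OF F] show ?thesis by (simp add: F_def deg_shift)
  qed
  thus ?thesis by blast
qed

lemma ex_nongap_shift:
  assumes D: "D \<in> divisors \<iota>"
  shows "\<exists>N. \<forall>n\<ge>N. nongap (D + multiple n P)"
proof -
  obtain N where N: "\<And>n. n \<ge> N \<Longrightarrow> int (dimL (D + multiple n P)) = deg D + n + 1 - genus \<iota>"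
    using ex_dimL_shift[OF D] by blast
  \<comment> \<open>The jump at \<open>n\<close> compares the dimensions at \<open>n\<close> and
    \<open>n - 1\<close>, so both must lie in the stable range; hence \<open>N + 1\<close>.\<close>
  have "nongap (D + multiple n P)" if "n \<ge> N + 1" for n
    using N[of n] N[of "n - 1"] that dimL_shift_step[OF D, of n] by (auto split: if_splits)
  thus ?thesis by blast
qed

lemma nongap_deg_nonneg:
  assumes D: "D \<in> divisors \<iota>" and "nongap D"
  shows "0 \<le> deg D"
proof (rule ccontr)
  assume "\<not> ?thesis"
  hence "L D = {0}" using RR_eq_zero_if_deg_neg[OF D] by simp
  thus False using assms(2) unfolding nongap_iff by auto
qed

text \<open>The jumps telescope upwards from \<open>a\<close>, where the degree is negative and the
  space is zero.\<close>

lemma dimL_eq_card_nongaps: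
  assumes D: "D \<in> divisors \<iota>" and "deg D + a < 0" "a \<le> b"
  shows "dimL (D + multiple b P) = card {i \<in> {a<..b}. nongap (D + multiple i P)}"
  using \<open>a \<le> b\<close>
proof (induction b rule: int_ge_induct)
  case base
  thus ?case using assms(2) by (simp add: dimL_eq_zero_if_deg_neg shift_in_divisors[OF D] deg_shift)
next
  case (step b)
  define S where "S = (\<lambda>b. {i \<in> {a<..b}. nongap (D + multiple i P)})"
  have fin: "finite (S b)" unfolding S_def by (rule finite_subset[of _ "{a<..b}"]) auto
  have "S (b + 1) = (if nongap (D + multiple (b + 1) P) then insert (b + 1) (S b) else S b)"
    using step.hyps by (auto simp: S_def zle_add1_eq_le le_less)
  moreover have "b + 1 \<notin> S b" by (simp add: S_def)
  ultimately have "card (S (b + 1)) = card (S b) + (if nongap (D + multiple (b + 1) P) then 1 else 0)"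
    using fin by simp
  thus ?case using dimL_shift_step[OF D, of "b + 1"] step.IH unfolding S_def by simp
qed

text \<open>A Weierstrass gap theorem for the shifts of \<open>D\<close>: among the
  \<open>deg D + b + 1\<close> shifts of nonnegative degree up to a large \<open>b\<close>, the
  nongaps number \<open>dim L(D + bP) = deg D + b + 1 - g\<close>. For \<open>D = 0\<close> it is
  the classical statement.\<close>

lemma card_gaps:
  assumes D: "D \<in> divisors \<iota>"
  defines "S \<equiv> {i. - deg D \<le> i \<and> \<not> nongap (D + multiple i P)}"
  shows "finite S \<and> int (card S) = genus \<iota>"
proof -
  obtain N1 where N1: "\<And>n. n \<ge> N1 \<Longrightarrow> int (dimL (D + multiple n P)) = deg D + n + 1 - genus \<iota>"
    using ex_dimL_shift[OF D] by blast
  obtain N2 where N2: "\<And>n. n \<ge> N2 \<Longrightarrow> nongap (D + multiple n P)" using ex_nongap_shift[OF D] by blast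
  define a where "a = - deg D - 1"
  define b where "b = max (max N1 N2) a"
  define G where "G = {i \<in> {a<..b}. nongap (D + multiple i P)}"
  have finG: "finite G" unfolding G_def by (rule finite_subset[of _ "{a<..b}"]) auto
  have S: "S = {a<..b} - G"
  proof -
    have "i \<le> b" if "i \<in> S" for i
      using that N2[of i] unfolding S_def b_def by (cases "i \<ge> N2") auto
    thus ?thesis unfolding S_def G_def a_def by auto
  qed
  have "dimL (D + multiple b P) = card G"
    unfolding G_def by (rule dimL_eq_card_nongaps[OF D]) (auto simp: a_def b_def)
  moreover have "int (dimL (D + multiple b P)) = deg D + b + 1 - genus \<iota>" by (rule N1) (simp add: b_def)
  moreover have "card S = card {a<..b} - card G"
    unfolding S by (rule card_Diff_subset[OF finG]) (auto simp: G_def)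
  moreover have "card G \<le> card {a<..b}" by (rule card_mono) (auto simp: G_def)
  moreover have "int (card {a<..b}) = b + deg D + 1" by (simp add: a_def b_def)
  ultimately show ?thesis using S by simp
qed

lemma nongap_if_deg_ge:
  assumes C: "C \<in> divisors \<iota>" and deg: "2 * genus \<iota> \<le> deg C"
  shows "nongap C"
proof (rule ccontr)
  assume gap: "\<not> nongap C"
  define S where "S = {i. - deg 0 \<le> i \<and> \<not> nongap (0 + multiple i P)}"
  define T where "T = {i. - deg C \<le> i \<and> \<not> nongap (C + multiple i P)}"
  have S: "finite S" "int (card S) = genus \<iota>"
    using card_gaps[OF divisors_zero] unfolding S_def by blast+
  have T: "finite T" "int (card T) = genus \<iota>"
    using card_gaps[OF C] unfolding T_def by blast+
  have "{0..deg C} \<subseteq> S \<union> uminus ` T"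
  proof
    fix i assume i: "i \<in> {0..deg C}"
    have "C = (0 + multiple i P) + (C + multiple (- i) P)"
      using shift_shift[of C "- i" i] by (simp add: shift_zero add.commute)
    hence "\<not> nongap (0 + multiple i P) \<or> \<not> nongap (C + multiple (- i) P)"
      using gap nongap_add by metis
    hence "i \<in> S \<or> - i \<in> T" using i by (auto simp: S_def T_def deg_zero)
    thus "i \<in> S \<union> uminus ` T" by force
  qed
  hence "card {0..deg C} \<le> card (S \<union> uminus ` T)" using S T by (intro card_mono) auto
  also have "\<dots> \<le> card S + card (uminus ` T)" by (rule card_Un_le)
  also have "\<dots> \<le> card S + card T" using card_image_le[OF T(1)] by simp
  finally have "int (card {0..deg C}) \<le> 2 * genus \<iota>" using S T by linarith
  \<comment> \<open>The genus is nonnegative, being the cardinality of \<open>S\<close>, so the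
    interval has its expected size.\<close>
  moreover have "int (card {0..deg C}) = deg C + 1" using deg S by simp
  ultimately show False using deg by simp
qed

section \<open>From divisor classes to the sets \<open>Delta\<close>\<close>

lemma class_in_Gamma_iff:
  assumes A: "A \<in> divisors \<iota>"
  shows "divisor_class \<iota> A \<in> Gamma \<iota> P \<longleftrightarrow> nongap A"
proof
  assume "nongap A"
  thus "divisor_class \<iota> A \<in> Gamma \<iota> P" using A unfolding Gamma_def nongap_def by blast
next
  assume "divisor_class \<iota> A \<in> Gamma \<iota> P"
  \<comment> \<open>The class of \<open>A\<close> may lie in \<open>Gamma\<close> through another
    representative \<open>B\<close>. With \<open>A - B\<close> the divisor of \<open>f\<close>,
    multiplication by \<open>1/f\<close> carries a function with the extremal pole order for
    \<open>B\<close> to one for \<open>A\<close>.\<close>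
  then obtain B where B: "B \<in> divisors \<iota>" "nongap B" "divisor_class \<iota> A = divisor_class \<iota> B"
    unfolding Gamma_def nongap_def by blast
  have "0 \<in> principal_divisors \<iota>"
    unfolding principal_divisors_def using divisors_zero pt_one by (auto intro!: exI[of _ 1])
  hence "A \<in> divisor_class \<iota> A" using A by (simp add: divisor_class_def)
  hence "A - B \<in> principal_divisors \<iota>" unfolding B(3) by (simp add: divisor_class_def)
  then obtain f where f: "f \<noteq> 0" "\<And>v. v \<in> points \<iota> \<Longrightarrow> Poly_Mapping.lookup (A - B) v = v f"
    unfolding principal_divisors_def by blast
  have "A - B = div_of f"
    by (rule poly_mapping_eqI)
       (use f lookup_outside[OF divisors_diff[OF A B(1)]] in \<open>auto simp: lookup_div_of\<close>)
  hence eq: "A = B + div_of f" by (simp add: algebra_simps)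
  obtain h where h: "h \<in> L B" "h \<noteq> 0" "P h = - Poly_Mapping.lookup B P"
    using B(2) unfolding nongap_iff by blast
  have "h * inverse f \<in> L A" unfolding eq using f(1) h by (simp add: RR_add_div_of mult.assoc)
  moreover have "P (h * inverse f) = - Poly_Mapping.lookup A P"
    unfolding eq using f(1) h
    by (simp add: pt_mult[OF P_point] pt_inverse[OF P_point] lookup_add lookup_div_of P_point)
  ultimately show "nongap A" unfolding nongap_iff using f h by (intro bexI[of _ "h * inverse f"]) auto
qed

lemma card_Delta:
  assumes "B \<in> divisors \<iota>" "C \<in> divisors \<iota>"
  defines "S \<equiv> {i. nongap (B + multiple i P) \<and> \<not> nongap (B - C + multiple i P)}"
  shows "finite (Delta \<iota> P B C) \<longleftrightarrow> finite S" "card (Delta \<iota> P B C) = card S"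
proof -
  have "Delta \<iota> P B C = (\<lambda>i. B + multiple i P) ` S"
    unfolding Delta_def S_def using assms(1,2)
    by (auto simp: class_in_Gamma_iff shift_in_divisors divisors_diff)
  moreover have "inj_on (\<lambda>i. B + multiple i P) S"
    by (rule inj_onI) (metis deg_shift add_left_cancel)
  ultimately show "finite (Delta \<iota> P B C) \<longleftrightarrow> finite S" "card (Delta \<iota> P B C) = card S"
    by (simp_all add: finite_image_iff card_image)
qed

lemma Delta_difference:
  assumes B: "B \<in> divisors \<iota>" and C: "C \<in> divisors \<iota>"
  shows "finite (Delta \<iota> P B C) \<and> finite (Delta \<iota> P (B - C) (- C)) \<and>
    int (card (Delta \<iota> P B C)) - int (card (Delta \<iota> P (B - C) (- C))) = deg C"
proof -
  define E where "E = B - C"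
  have E: "E \<in> divisors \<iota>" unfolding E_def by (rule divisors_diff[OF B C])
  obtain M1 where M1: "\<And>n. n \<ge> M1 \<Longrightarrow> int (dimL (B + multiple n P)) = deg B + n + 1 - genus \<iota>"
    using ex_dimL_shift[OF B] by blast
  obtain M2 where M2: "\<And>n. n \<ge> M2 \<Longrightarrow> int (dimL (E + multiple n P)) = deg E + n + 1 - genus \<iota>"
    using ex_dimL_shift[OF E] by blast
  obtain N1 where N1: "\<And>n. n \<ge> N1 \<Longrightarrow> nongap (B + multiple n P)" using ex_nongap_shift[OF B] by blast
  obtain N2 where N2: "\<And>n. n \<ge> N2 \<Longrightarrow> nongap (E + multiple n P)" using ex_nongap_shift[OF E] by blast
  \<comment> \<open>Up to \<open>a\<close> both degrees are negative and neither shift is a nongap;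
    beyond \<open>b\<close> both are. So the two sets of nongaps differ only inside
    \<open>{a<..b}\<close>, where dimensions count them.\<close>
  define a where "a = min (- deg B) (- deg E) - 1"
  define b where "b = max a (max (max M1 M2) (max N1 N2))"
  define I where "I = {i \<in> {a<..b}. nongap (B + multiple i P)}"
  define J where "J = {i \<in> {a<..b}. nongap (E + multiple i P)}"
  have fin: "finite I" "finite J" unfolding I_def J_def by (rule finite_subset[of _ "{a<..b}"]; auto)+
  have low: "a < i" if "nongap (B + multiple i P) \<or> nongap (E + multiple i P)" for i
    using that nongap_deg_nonneg[OF shift_in_divisors[OF B, of i]]
      nongap_deg_nonneg[OF shift_in_divisors[OF E, of i]] by (auto simp: deg_shift a_def)
  have high: "i \<le> b" if "\<not> nongap (B + multiple i P) \<or> \<not> nongap (E + multiple i P)" for i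
  proof (rule ccontr)
    assume "\<not> i \<le> b"
    hence "i \<ge> N1" "i \<ge> N2" by (auto simp: b_def)
    thus False using that N1 N2 by blast
  qed
  have S1: "{i. nongap (B + multiple i P) \<and> \<not> nongap (B - C + multiple i P)} = I - J"
    using low high unfolding I_def J_def E_def[symmetric] by auto
  have S2: "{i. nongap (B - C + multiple i P) \<and> \<not> nongap (B - C - (- C) + multiple i P)} = J - I"
    using low high unfolding I_def J_def E_def[symmetric] by (auto simp: E_def)
  have "card I = dimL (B + multiple b P)"
    unfolding I_def by (rule dimL_eq_card_nongaps[OF B, symmetric]) (auto simp: a_def b_def)
  moreover have "card J = dimL (E + multiple b P)"
    unfolding J_def by (rule dimL_eq_card_nongaps[OF E, symmetric]) (auto simp: a_def b_def)
  moreover have "deg B - deg E = deg C" by (simp add: E_def deg_diff)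
  ultimately have "int (card I) - int (card J) = deg C"
    using M1[of b] M2[of b] unfolding b_def by linarith
  moreover have "int (card (I - J)) - int (card (J - I)) = int (card I) - int (card J)"
    using card_Diff_subset_Int[of I J] card_Diff_subset_Int[of J I] fin
      card_mono[of I "I \<inter> J"] card_mono[of J "I \<inter> J"] by (simp add: Int_commute)
  ultimately show ?thesis
    using card_Delta[OF B C] card_Delta[OF divisors_diff[OF B C] divisors_minus[OF C]] fin
    unfolding S1 S2 by simp
qed

lemma Delta_empty:
  assumes B: "B \<in> divisors \<iota>" and C: "C \<in> divisors \<iota>" and "nongap (- C)"
  shows "Delta \<iota> P B C = {}"
proof -
  have "nongap (B - C + multiple i P)" if "nongap (B + multiple i P)" for i
    using nongap_add[OF that assms(3)] by (simp add: algebra_simps)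
  thus ?thesis unfolding Delta_def using B C
    by (auto simp: class_in_Gamma_iff shift_in_divisors divisors_diff)
qed

end

theorem lemma5p4:
  fixes \<iota> :: "'k::{field,finite} \<Rightarrow> 'f::field"
    and P :: "'f point"
    and B C :: "'f divisor"
  assumes "function_field \<iota>"
    and "rational_point \<iota> P"
    and "B \<in> divisors \<iota>"
    and "C \<in> divisors \<iota>"
  shows "finite (Delta \<iota> P B C) \<and> finite (Delta \<iota> P (B - C) (- C)) \<and>
    int (card (Delta \<iota> P B C)) - int (card (Delta \<iota> P (B - C) (- C))) = divisor_degree \<iota> C \<and>
    (divisor_class \<iota> C \<in> Gamma \<iota> P \<longrightarrow> int (card (Delta \<iota> P B C)) = divisor_degree \<iota> C) \<and>
    (divisor_class \<iota> (- C) \<in> Gamma \<iota> P \<longrightarrow> card (Delta \<iota> P B C) = 0) \<and>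
    (divisor_degree \<iota> C \<ge> 2 * genus \<iota> \<longrightarrow> int (card (Delta \<iota> P B C)) = divisor_degree \<iota> C) \<and>
    (divisor_degree \<iota> C \<le> - 2 * genus \<iota> \<longrightarrow> card (Delta \<iota> P B C) = 0)"
proof -
  interpret function_field \<iota> by fact
  interpret pointed_function_field \<iota> P by unfold_locales fact
  have nC: "- C \<in> divisors \<iota>" by (rule divisors_minus) fact
  have BC: "B - C \<in> divisors \<iota>" by (rule divisors_diff) fact+
  note diff = Delta_difference[OF assms(3,4)]
  \<comment> \<open>\<open>Delta_empty\<close> applies to \<open>B - C\<close> and
    \<open>- C\<close>, whose negative is \<open>C\<close>: the second set is empty and the
    difference formula gives the size of the first.\<close>
  have pos: "int (card (Delta \<iota> P B C)) = divisor_degree \<iota> C" if "nongap C"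
    using diff Delta_empty[OF BC nC] that by simp
  have neg: "card (Delta \<iota> P B C) = 0" if "nongap (- C)"
    using Delta_empty[OF assms(3,4) that] by simp
  show ?thesis
    using diff pos neg nongap_if_deg_ge[OF assms(4)] nongap_if_deg_ge[OF nC]
      class_in_Gamma_iff[OF assms(4)] class_in_Gamma_iff[OF nC] by (simp add: deg_minus)
qed

end
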